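(* Let $q\ge 3$ be an integer. For $x,y\in\mathbb{R}$ the following properties are equivalent: (1) $x$ and $y$ are $G_q$-equivalent, i.e. there is $g\in G_q$ with $g\,x=y$. (2) $x\sim_{\mathrm{reg}}y$, or ($x\sim_{\mathrm{reg}}r_q$ and $y\sim_{\mathrm{reg}}-r_q$), or ($x\sim_{\mathrm{reg}}-r_q$ and $y\sim_{\mathrm{reg}}r_q$).
   Context: Let $\lambda_q=2\cos(\pi/q)$. The Hecke triangle group $G_q\subset \mathrm{PSL}(2,\mathbb{R})$ is generated by $S=\begin{pmatrix}0&-1\\1&0\end{pmatrix}$ and $T_q=\begin{pmatrix}1&\lambda_q\\0&1\end{pmatrix}$ and acts on $\mathbb{R}\cup\{\infty\}$ by Möbius transformations. Put $h_q=\frac{q-2}{2}$ for $q$ even and $h_q=\frac{q-3}{2}$ for $q$ odd. In finite or infinite sequences, $(a)^k$ means $a$ repeated $k$ times (absent if $k=0$), and an overline marks a period. The set $\mathcal{B}_q$ of forbidden blocks (same sign throughout each block) is: for $q=3$: $(\pm1)$ and $(\pm2,\pm m)$, $m\ge1$; for $q$ even: $((\pm1)^{h_q+1})$ and $((\pm1)^{h_q},\pm m)$, $m\ge1$; for $q\ge5$ odd: $((\pm1)^{h_q+1})$ and $((\pm1)^{h_q},\pm2,(\pm1)^{h_q},\pm m)$, $m\ge1$. A $\lambda_q$-CF is a finite or infinite expansion $[a_0;a_1,a_2,\dots]=a_0\lambda_q+\cfrac{-1}{a_1\lambda_q+\cfrac{-1}{a_2\lambda_q+\cdots}}$ with $a_0\in\mathbb{Z}$,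 $a_i\in\mathbb{Z}\setminus\{0\}$ for $i\ge1$; the value of an infinite one is $\lim_{L\to\infty}[a_0;a_1,\dots,a_L]$. It is regular if no block $(a_l,a_{l+1},\dots,a_L)$ with $1\le l\le L$ belongs to $\mathcal{B}_q$. Regular $\lambda_q$-CF's converge and every real number has a regular $\lambda_q$-CF. The relation $\sim_{\mathrm{reg}}$ on $\mathbb{R}$: if $x,y$ have infinite regular $\lambda_q$-CF's $[a_0;a_1,\dots]$ and $[b_0;b_1,\dots]$, then $x\sim_{\mathrm{reg}}y$ iff these have the same tail, i.e. there are $m,n\in\mathbb{N}$ such that $(a_m,a_{m+1},\dots)=(b_n,b_{n+1},\dots)$. In addition, all real numbers with finite regular $\lambda_q$-CF's are declared to be $\sim_{\mathrm{reg}}$-equivalent to each other. The point $r_q$ is given by $r_3=[0;\overline{3}]$; $r_q=[0;\overline{(1)^{h_q-1},2}]$ for $q$ even; $r_q=[0;\overline{(1)^{h_q},2,(1)^{h_q-1},2}]$ for $q\ge5$ odd. *)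

theory Defs
  imports "HOL-Analysis.Analysis" "HOL-Algebra.Generated_Groups"
begin

definition hecke_lambda :: "nat \<Rightarrow> real" where
  "hecke_lambda q = 2 * cos (pi / real q)"

definition SL2R :: "(real^2^2) monoid" where
  "SL2R = \<lparr>carrier = {M. det M = 1}, mult = (**), one = mat 1\<rparr>"

definition PSL2R :: "(real^2^2) set monoid" where
  "PSL2R = SL2R Mod {mat 1, - mat 1}"

definition psl_class :: "real^2^2 \<Rightarrow> (real^2^2) set" where
  "psl_class M = {mat 1, - mat 1} #>\<^bsub>SL2R\<^esub> M"

definition hecke_S :: "real^2^2" where
  "hecke_S = vector [vector [0, -1], vector [1, 0]]"

definition hecke_T :: "nat \<Rightarrow> real^2^2" where
  "hecke_T q = vector [vector [1, hecke_lambda q], vector [0, 1]]"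

definition hecke_group :: "nat \<Rightarrow> (real^2^2) set set" where
  "hecke_group q = generate PSL2R {psl_class hecke_S, psl_class (hecke_T q)}"

(* The projective line is modelled by the type real option, with None for the point at infinity. *)
fun moebius_real :: "real^2^2 \<Rightarrow> real option \<Rightarrow> real option" where
  "moebius_real M None = (if M$2$1 = 0 then None else Some (M$1$1 / M$2$1))"
| "moebius_real M (Some x) =
     (if M$2$1 * x + M$2$2 = 0 then None
      else Some ((M$1$1 * x + M$1$2) / (M$2$1 * x + M$2$2)))"

(* M and - M act alike, so for an element g of PSL2R the image set below is a singleton. *)
definition psl_act :: "(real^2^2) set \<Rightarrow> real option \<Rightarrow> real option" where
  "psl_act g p = the_elem ((\<lambda>M. moebius_real M p) ` g)"

definition hecke_h :: "nat \<Rightarrow> nat" where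
  "hecke_h q = (if even q then (q - 2) div 2 else (q - 3) div 2)"

definition positive_forbidden_blocks :: "nat \<Rightarrow> int list set" where
  "positive_forbidden_blocks q =
    (let h = hecke_h q in
     if q = 3 then {[1]} \<union> {[2, m] |m. m \<ge> 1}
     else if even q then {replicate (h + 1) 1} \<union> {replicate h 1 @ [m] |m. m \<ge> 1}
     else {replicate (h + 1) 1} \<union> {replicate h 1 @ [2] @ replicate h 1 @ [m] |m. m \<ge> 1})"

definition forbidden_blocks :: "nat \<Rightarrow> int list set" where
  "forbidden_blocks q =
    positive_forbidden_blocks q \<union> map uminus ` positive_forbidden_blocks q"

(* A finite expansion is the nonempty list of its digits a_0, ..., a_L; the equation for the
   empty list is a dummy. No tail of a regular expansion vanishes, so the convention
   x / 0 = 0 does not affect the values of regular expansions. *)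
fun lcf_value :: "nat \<Rightarrow> int list \<Rightarrow> real" where
  "lcf_value q [] = 0"
| "lcf_value q [a] = of_int a * hecke_lambda q"
| "lcf_value q (a # b # as) = of_int a * hecke_lambda q + (-1) / lcf_value q (b # as)"

definition lcf_convergent :: "nat \<Rightarrow> (nat \<Rightarrow> int) \<Rightarrow> nat \<Rightarrow> real" where
  "lcf_convergent q a L = lcf_value q (map a [0..<Suc L])"

definition regular_finite :: "nat \<Rightarrow> int list \<Rightarrow> bool" where
  "regular_finite q as \<longleftrightarrow>
     as \<noteq> [] \<and> (\<forall>i. 1 \<le> i \<and> i < length as \<longrightarrow> as ! i \<noteq> 0) \<and>
     (\<forall>l L. 1 \<le> l \<and> l \<le> L \<and> L < length as \<longrightarrow>
        map ((!) as) [l..<Suc L] \<notin> forbidden_blocks q)"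

definition regular_infinite :: "nat \<Rightarrow> (nat \<Rightarrow> int) \<Rightarrow> bool" where
  "regular_infinite q a \<longleftrightarrow>
     (\<forall>i\<ge>1. a i \<noteq> 0) \<and>
     (\<forall>l L. 1 \<le> l \<and> l \<le> L \<longrightarrow> map a [l..<Suc L] \<notin> forbidden_blocks q)"

definition finite_reg_expansion :: "nat \<Rightarrow> int list \<Rightarrow> real \<Rightarrow> bool" where
  "finite_reg_expansion q as x \<longleftrightarrow> regular_finite q as \<and> lcf_value q as = x"

definition infinite_reg_expansion :: "nat \<Rightarrow> (nat \<Rightarrow> int) \<Rightarrow> real \<Rightarrow> bool" where
  "infinite_reg_expansion q a x \<longleftrightarrow> regular_infinite q a \<and> lcf_convergent q a \<longlonglongrightarrow> x"

definition reg_equiv :: "nat \<Rightarrow> real \<Rightarrow> real \<Rightarrow> bool" where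
  "reg_equiv q x y \<longleftrightarrow>
     (\<exists>a b. infinite_reg_expansion q a x \<and> infinite_reg_expansion q b y \<and>
        (\<exists>m n. \<forall>k. a (m + k) = b (n + k))) \<or>
     ((\<exists>as. finite_reg_expansion q as x) \<and> (\<exists>bs. finite_reg_expansion q bs y))"

definition r_period :: "nat \<Rightarrow> int list" where
  "r_period q =
    (let h = hecke_h q in
     if q = 3 then [3]
     else if even q then replicate (h - 1) 1 @ [2]
     else replicate h 1 @ [2] @ replicate (h - 1) 1 @ [2])"

definition r_digits :: "nat \<Rightarrow> nat \<Rightarrow> int" where
  "r_digits q i = (if i = 0 then 0 else r_period q ! ((i - 1) mod length (r_period q)))"

definition r_point :: "nat \<Rightarrow> real" where
  "r_point q = lim (lcf_convergent q (r_digits q))"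

end

theory Submission
  imports Defs
begin

text \<open>
  A shift by \<open>\<lambda>\<close> only changes the digit \<open>a\<^sub>0\<close>, so everything rests on comparing the expansions of
  \<open>z\<close> and \<open>- 1 / z\<close>. If \<open>\<bar>z\<bar> < \<lambda> / 2\<close> or \<open>\<bar>z\<bar> > 2 / \<lambda>\<close>, one of them is a tail of the other. For \<open>z\<close>
  strictly in between (taken positive), put \<open>f t = - 1 / (\<lambda> + t)\<close>, the effect of a digit 1. Since
  \<open>f\<close> has order \<open>q\<close>, there is \<open>t > 0\<close> with \<open>z = \<lambda> + f\<^sup>h t\<close>, while \<open>1 / z = \<lambda> + f\<^sup>h (1 / t)\<close> for \<open>q\<close>
  even and \<open>1 / z = \<lambda> + f\<^sup>h\<^sup>+\<^sup>1 (1 / t)\<close> for \<open>q\<close> odd. Hence \<open>z, - 1 / z\<close> have the tails of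
  \<open>t, - 1 / t\<close>, and the comparison is repeated with \<open>t\<close>. Either it stops, and the tails of \<open>z\<close> and
  \<open>- 1 / z\<close> agree, or it goes on forever, and then all digits are determined: \<open>z\<close> has the tail of
  \<open>r\<^sub>q\<close> and \<open>- 1 / z\<close> that of \<open>- r\<^sub>q\<close>.

  Tails are compared through the orbits of the nearest-\<open>\<lambda>\<close>-multiple map, whose digit sequences are
  regular and converge because that map expands on \<open>[- \<lambda> / 2, \<lambda> / 2]\<close>.
\<close>

section \<open>The action of the Hecke group on the projective line\<close>

lemma SL2R_simps [simp]:
  "carrier SL2R = {M. det M = 1}" "mult SL2R = (**)" "one SL2R = mat 1"
  by (simp_all add: SL2R_def)

lemma group_SL2R: "group SL2R"
proof (rule groupI)
  fix M assume "M \<in> carrier SL2R"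
  then have M: "det M = 1" by simp
  then obtain N where inv: "N ** M = mat 1"
    by (metis invertible_def invertible_det_nz zero_neq_one)
  then have "det N = 1" using M by (metis det_I det_mul mult.right_neutral)
  then show "\<exists>N\<in>carrier SL2R. N \<otimes>\<^bsub>SL2R\<^esub> M = \<one>\<^bsub>SL2R\<^esub>" using inv by auto
qed (auto simp: det_mul matrix_mul_assoc)

lemma det_uminus_2: "det (- M :: real^2^2) = det M"
  by (simp add: det_2)

lemma matrix_mul_uminus_2:
  "- M ** N = - (M ** N)" "M ** - N = - (M ** (N :: real^2^2))"
  by (simp_all add: vec_eq_iff matrix_matrix_mult_def sum_negf)

lemma normal_PSL2R: "normal {mat 1, - mat 1} SL2R"
proof -
  interpret group SL2R by (rule group_SL2R)
  have "inv\<^bsub>SL2R\<^esub> (- mat 1) = - mat 1"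
    by (rule inv_equality) (simp_all add: matrix_mul_uminus_2 det_uminus_2)
  moreover have "inv\<^bsub>SL2R\<^esub> (mat 1) = mat 1" using inv_one by simp
  ultimately have "subgroup {mat 1, - mat 1} SL2R"
    by (intro subgroup.intro) (auto simp: matrix_mul_uminus_2 det_uminus_2)
  moreover have "M ** inv\<^bsub>SL2R\<^esub> M = mat 1" if "det M = 1" for M
    using r_inv[of M] that by simp
  ultimately show ?thesis
    unfolding normal_inv_iff by (auto simp: matrix_mul_uminus_2)
qed

lemma group_PSL2R: "group PSL2R"
  unfolding PSL2R_def by (rule normal.factorgroup_is_group[OF normal_PSL2R])

lemma psl_class_eq: "psl_class M = {M, - M}"
  by (auto simp: psl_class_def r_coset_def matrix_mul_uminus_2)

lemma psl_class_mult:
  "det M = 1 \<Longrightarrow> det N = 1 \<Longrightarrow> psl_class M \<otimes>\<^bsub>PSL2R\<^esub> psl_class N = psl_class (M ** N)"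
  unfolding PSL2R_def psl_class_def using normal.rcos_sum[OF normal_PSL2R, of M N]
  by (simp add: FactGroup_def)

lemma psl_class_one: "\<one>\<^bsub>PSL2R\<^esub> = psl_class (mat 1)"
  by (simp add: PSL2R_def FactGroup_def psl_class_eq)

lemma PSL2R_carrier: "g \<in> carrier PSL2R \<longleftrightarrow> (\<exists>M. det M = 1 \<and> g = psl_class M)"
  by (auto simp: PSL2R_def FactGroup_def RCOSETS_def psl_class_def)

section \<open>The Moebius action of PSL(2,R)\<close>

lemma moebius_real_uminus: "moebius_real (- M) p = moebius_real M p"
proof (cases p)
  case (Some x)
  have "- (M $ 2 $ 1) * x + - (M $ 2 $ 2) = - (M $ 2 $ 1 * x + M $ 2 $ 2)"
    "- (M $ 1 $ 1) * x + - (M $ 1 $ 2) = - (M $ 1 $ 1 * x + M $ 1 $ 2)" by simp_all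
  moreover have "- a / - b = a / b" for a b :: real by simp
  ultimately show ?thesis unfolding Some moebius_real.simps vector_uminus_component
    by (simp only: neg_equal_0_iff_equal)
qed simp

text \<open>Homogeneous coordinates: matrices act on them linearly, so composition needs no case
  split on vanishing denominators. The meaningless pair (0, 0) is excluded in
  \<open>moebius_real_proj_point\<close>.\<close>

definition proj_point :: "real \<Rightarrow> real \<Rightarrow> real option" where
  "proj_point u v = (if v = 0 then None else Some (u / v))"

lemma proj_point_scale: "c \<noteq> 0 \<Longrightarrow> proj_point (u * c) (v * c) = proj_point u v"
  by (simp add: proj_point_def)

lemma moebius_real_proj_point:
  assumes "u \<noteq> 0 \<or> v \<noteq> 0"
  shows "moebius_real M (proj_point u v) =
    proj_point (M$1$1 * u + M$1$2 * v) (M$2$1 * u + M$2$2 * v)"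
proof (cases "v = 0")
  case True
  then show ?thesis using assms by (simp add: proj_point_def)
next
  case False
  have "moebius_real M (proj_point u v) =
      proj_point (M$1$1 * (u / v) + M$1$2) (M$2$1 * (u / v) + M$2$2)"
    using False by (simp add: proj_point_def)
  also have "\<dots> = proj_point ((M$1$1 * (u / v) + M$1$2) * v) ((M$2$1 * (u / v) + M$2$2) * v)"
    by (rule proj_point_scale[OF False, symmetric])
  finally show ?thesis using False by (simp add: distrib_right)
qed

lemma moebius_real_mult:
  assumes "det N \<noteq> 0"
  shows "moebius_real (M ** N) p = moebius_real M (moebius_real N p)"
proof -
  obtain u v where p: "p = proj_point u v" "u \<noteq> 0 \<or> v \<noteq> 0"
  proof (cases p)
    case None
    then show thesis using that[of 1 0] by (simp add: proj_point_def)
  next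
    case (Some x)
    then show thesis using that[of x 1] by (simp add: proj_point_def)
  qed
  let ?u = "N$1$1 * u + N$1$2 * v" and ?v = "N$2$1 * u + N$2$2 * v"
  have "?u \<noteq> 0 \<or> ?v \<noteq> 0"
  proof (rule ccontr)
    assume "\<not> ?thesis"
    then have z: "?u = 0" "?v = 0" by blast+
    \<comment> \<open>The adjugate of \<open>N\<close> recovers \<open>det N\<close> times the
      coordinates, so a vanishing image would force \<open>u\<close> and \<open>v\<close> to
      vanish.\<close>
    have "det N * u = N$2$2 * ?u - N$1$2 * ?v" by (simp add: det_2 algebra_simps)
    moreover have "det N * v = N$1$1 * ?v - N$2$1 * ?u" by (simp add: det_2 algebra_simps)
    ultimately have "det N * u = 0 \<and> det N * v = 0" unfolding z by simp
    then show False using assms p(2) by simp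
  qed
  then show ?thesis
    unfolding p(1) moebius_real_proj_point[OF p(2)] by (subst moebius_real_proj_point)
      (auto simp: matrix_matrix_mult_def sum_2 algebra_simps)
qed

lemma moebius_real_one: "moebius_real (mat 1) p = p"
  by (cases p) (simp_all add: mat_def)

lemma psl_act_class: "psl_act (psl_class M) p = moebius_real M p"
  by (simp add: psl_act_def psl_class_eq moebius_real_uminus)

lemma psl_act_one: "psl_act \<one>\<^bsub>PSL2R\<^esub> p = p"
  by (simp add: psl_class_one psl_act_class moebius_real_one)

lemma psl_act_mult:
  "g \<in> carrier PSL2R \<Longrightarrow> g' \<in> carrier PSL2R \<Longrightarrow>
    psl_act (g \<otimes>\<^bsub>PSL2R\<^esub> g') p = psl_act g (psl_act g' p)"
  by (auto simp: PSL2R_carrier psl_class_mult psl_act_class moebius_real_mult)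

lemma psl_act_inv:
  assumes "g \<in> carrier PSL2R"
  shows "psl_act (inv\<^bsub>PSL2R\<^esub> g) (psl_act g p) = p" "psl_act g (psl_act (inv\<^bsub>PSL2R\<^esub> g) p) = p"
  using group.inv_closed[OF group_PSL2R assms] assms
  by (simp_all add: group.l_inv[OF group_PSL2R] group.r_inv[OF group_PSL2R] psl_act_one
      flip: psl_act_mult)

lemma hecke_generators_carrier: "{psl_class hecke_S, psl_class (hecke_T q)} \<subseteq> carrier PSL2R"
proof -
  have "det hecke_S = 1" "det (hecke_T q) = 1" by (simp_all add: hecke_S_def hecke_T_def det_2)
  then show ?thesis by (auto simp: PSL2R_carrier)
qed

lemma subgroup_hecke_group: "subgroup (hecke_group q) PSL2R"
  unfolding hecke_group_def
  by (rule group.generate_is_subgroup[OF group_PSL2R hecke_generators_carrier])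

lemma hecke_S_act:
  "psl_act (psl_class hecke_S) (Some x) = (if x = 0 then None else Some (- 1 / x))"
  "psl_act (psl_class hecke_S) None = Some 0"
  by (simp_all add: psl_act_class hecke_S_def)

lemma hecke_T_act:
  "psl_act (psl_class (hecke_T q)) (Some x) = Some (x + hecke_lambda q)"
  "psl_act (psl_class (hecke_T q)) None = None"
  by (simp_all add: psl_act_class hecke_T_def)

section \<open>Orbits of the Hecke group\<close>

definition same_orbit :: "nat \<Rightarrow> real option \<Rightarrow> real option \<Rightarrow> bool" where
  "same_orbit q p p' \<longleftrightarrow> (\<exists>g\<in>hecke_group q. psl_act g p = p')"

lemma same_orbit_refl [simp]: "same_orbit q p p"
  unfolding same_orbit_def using subgroup.one_closed[OF subgroup_hecke_group] psl_act_one by blast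

lemma same_orbit_sym: "same_orbit q p p' \<Longrightarrow> same_orbit q p' p"
  unfolding same_orbit_def
  using subgroup.m_inv_closed[OF subgroup_hecke_group] subgroup.mem_carrier[OF subgroup_hecke_group]
    psl_act_inv(1) by metis

lemma same_orbit_trans [trans]: "same_orbit q p p' \<Longrightarrow> same_orbit q p' p'' \<Longrightarrow> same_orbit q p p''"
  unfolding same_orbit_def
  using subgroup.m_closed[OF subgroup_hecke_group] subgroup.mem_carrier[OF subgroup_hecke_group]
    psl_act_mult by metis

lemma same_orbit_S: "x \<noteq> 0 \<Longrightarrow> same_orbit q (Some x) (Some (- 1 / x))" "same_orbit q (Some 0) None"
  unfolding same_orbit_def hecke_group_def using generate.incl[of "psl_class hecke_S"] hecke_S_act
  by (metis insertI1)+

lemma same_orbit_T: "same_orbit q (Some x) (Some (x + hecke_lambda q))"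
  unfolding same_orbit_def hecke_group_def
  using generate.incl[of "psl_class (hecke_T q)"] hecke_T_act
  by (metis insertI1 insertI2)

lemma same_orbit_add: "same_orbit q (Some x) (Some (of_int n * hecke_lambda q + x))"
proof -
  have nat: "same_orbit q (Some x) (Some (real n * hecke_lambda q + x))" for n x
  proof (induction n)
    case (Suc n)
    have "same_orbit q (Some (real n * hecke_lambda q + x)) (Some (real (Suc n) * hecke_lambda q + x))"
      using same_orbit_T[of q "real n * hecke_lambda q + x"] by (simp add: algebra_simps)
    then show ?case using Suc same_orbit_trans by blast
  qed simp
  show ?thesis
  proof (cases "n \<ge> 0")
    case True
    then show ?thesis using nat[of x "nat n"] by simp
  next
    case False
    then show ?thesis
      using same_orbit_sym[OF nat[of "of_int n * hecke_lambda q + x" "nat (- n)"]] by simp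
  qed
qed

text \<open>Symmetry of \<open>R\<close> takes care of inverse generators and transitivity of
  products, so only the two generators have to be checked.\<close>

lemma same_orbit_induct:
  assumes "same_orbit q p p'"
    and R: "\<And>p. R p p" "\<And>p p'. R p p' \<Longrightarrow> R p' p" "\<And>p p' p''. R p p' \<Longrightarrow> R p' p'' \<Longrightarrow> R p p''"
    and S: "\<And>p. R p (psl_act (psl_class hecke_S) p)"
    and T: "\<And>p. R p (psl_act (psl_class (hecke_T q)) p)"
  shows "R p p'"
proof -
  let ?H = "{psl_class hecke_S, psl_class (hecke_T q)}"
  have "\<forall>p. R p (psl_act g p)" if "g \<in> generate PSL2R ?H" for g
    using that
  proof (induction g rule: generate.induct)
    case one
    then show ?case using R(1) psl_act_one by simp
  next
    case (incl g)
    then show ?case using S T by auto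
  next
    case (inv g)
    then have g: "g \<in> carrier PSL2R" and Rg: "R p (psl_act g p)" for p
      using hecke_generators_carrier S T by auto
    show ?case
    proof
      fix p
      show "R p (psl_act (inv\<^bsub>PSL2R\<^esub> g) p)"
        using R(2)[OF Rg[of "psl_act (inv\<^bsub>PSL2R\<^esub> g) p"]] psl_act_inv(2)[OF g] by simp
    qed
  next
    case (eng g g')
    then have "g \<in> carrier PSL2R" "g' \<in> carrier PSL2R"
      using group.generate_in_carrier[OF group_PSL2R hecke_generators_carrier] by blast+
    then have "psl_act (g \<otimes>\<^bsub>PSL2R\<^esub> g') p = psl_act g (psl_act g' p)" for p
      by (rule psl_act_mult)
    then show ?case using eng.IH R(3) by metis
  qed
  then show ?thesis using assms(1) unfolding same_orbit_def hecke_group_def by blast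
qed

section \<open>The elliptic map of order \<open>q\<close>\<close>

locale hecke =
  fixes q :: nat
  assumes q_ge_3: "q \<ge> 3"
begin

abbreviation lam :: real where "lam \<equiv> hecke_lambda q"
abbreviation h :: nat where "h \<equiv> hecke_h q"

text \<open>Up to sign and the factor sin (pi / q), these are the entries of the powers of the
  matrix of \<open>f\<close>, i.e. Chebyshev polynomials of the second kind at
  \<open>lam / 2\<close>.\<close>

definition sn :: "nat \<Rightarrow> real" where "sn k = sin (real k * pi / real q)"

definition f :: "real \<Rightarrow> real" where "f t = - 1 / (lam + t)"

lemma q_even: "even q \<Longrightarrow> q = 2 * h + 2"
  using q_ge_3 by (auto simp: hecke_h_def elim!: evenE)

lemma q_odd: "odd q \<Longrightarrow> q = 2 * h + 3"
  using q_ge_3 by (auto simp: hecke_h_def elim!: oddE)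

lemma h_pos: "even q \<Longrightarrow> h \<ge> 1"
  using q_even q_ge_3 by linarith

lemma h_eq_0: "h = 0 \<longleftrightarrow> q = 3"
  using q_even q_odd q_ge_3 by (cases "even q") (force, linarith)

lemma two_h: "2 * h + 2 \<le> q"
  using q_even q_odd by (cases "even q") auto

lemma lam_ge_1: "lam \<ge> 1"
proof -
  have "cos (pi / 3) \<le> cos (pi / real q)"
    using q_ge_3 by (intro cos_monotone_0_pi_le) (auto simp: field_simps)
  then show ?thesis by (simp add: hecke_lambda_def cos_60)
qed

lemma lam_less_2: "lam < 2"
proof -
  have "cos (pi / real q) < cos 0"
    using q_ge_3 by (intro cos_monotone_0_pi) (auto simp: field_simps)
  then show ?thesis by (simp add: hecke_lambda_def)
qed

lemma lam_pos: "lam > 0" using lam_ge_1 by simp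

lemma lam_q3: "q = 3 \<Longrightarrow> lam = 1"
  by (simp add: hecke_lambda_def cos_60)

section \<open>Sines of multiples of pi / q\<close>

lemma sn_0 [simp]: "sn 0 = 0" by (simp add: sn_def)

lemma sn_rec: "sn (k + 2) = lam * sn (k + 1) - sn k"
proof -
  have a: "real (k + 2) * pi / q = real (k + 1) * pi / q + pi / q"
    "real k * pi / q = real (k + 1) * pi / q - pi / q"
    by (simp_all add: algebra_simps add_divide_distrib)
  show ?thesis unfolding sn_def a sin_add sin_diff hecke_lambda_def by simp
qed

lemma sn_Suc_Suc: "sn (Suc (Suc k)) = lam * sn (Suc k) - sn k"
  using sn_rec[of k] by simp

lemma sn_sym: "j + k = q \<Longrightarrow> sn j = sn k"
proof -
  assume "j + k = q"
  then have "real j * pi / q = pi - real k * pi / q"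
    using q_ge_3 by (simp add: field_simps flip: of_nat_add distrib_left)
  then show ?thesis by (simp add: sn_def)
qed

lemma sn_pos: "0 < k \<Longrightarrow> k < q \<Longrightarrow> sn k > 0"
  unfolding sn_def by (intro sin_gt_zero) (auto simp: field_simps)

lemma sn_less: "j < k \<Longrightarrow> 2 * k \<le> q \<Longrightarrow> sn j < sn k"
proof -
  assume "j < k" "2 * k \<le> q"
  then have "2 * real k \<le> real q" by linarith
  then show ?thesis using \<open>j < k\<close> q_ge_3
    unfolding sn_def by (intro sin_monotone_2pi) (auto simp: field_simps intro: order_trans[of _ 0])
qed

text \<open>Reflection at \<open>q / 2\<close>, which is \<open>h + 1\<close> for \<open>q\<close>
  even and midway between \<open>h + 1\<close> and \<open>h + 2\<close> for \<open>q\<close>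
  odd.\<close>

lemma sn_even: "even q \<Longrightarrow> sn (Suc (Suc h)) = sn h"
  using q_even by (intro sn_sym) simp

lemma sn_odd: "odd q \<Longrightarrow> sn (Suc (Suc h)) = sn (Suc h)" "odd q \<Longrightarrow> sn (Suc (Suc (Suc h))) = sn h"
  using q_odd by (intro sn_sym; simp)+

section \<open>Closed form and bounds for the iterates of \<open>f\<close>\<close>

lemma sn_den_pos: "0 \<le> t \<Longrightarrow> Suc k < q \<Longrightarrow> sn k * t + sn (Suc k) > 0"
  using sn_pos[of "Suc k"] sn_pos[of k] by (cases "k = 0") (auto intro: add_nonneg_pos)

text \<open>After adding \<open>lam\<close>, numerator and denominator are consecutive linear forms
  in \<open>t\<close>, and the recursion for \<open>sn\<close> moves both one index further. The
  bound on \<open>k\<close> keeps the denominators positive.\<close>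

lemma f_iter_closed:
  assumes "0 \<le> t" "Suc k < q"
  shows "lam + (f ^^ k) t = (sn (Suc k) * t + sn (Suc (Suc k))) / (sn k * t + sn (Suc k))"
  using assms(2)
proof (induction k)
  case 0
  have "sn (Suc 0) > 0" using sn_pos[of 1] q_ge_3 by simp
  then show ?case by (simp add: sn_Suc_Suc field_simps)
next
  case (Suc k)
  have p: "sn (Suc k) * t + sn (Suc (Suc k)) > 0"
    using sn_den_pos[OF assms(1) Suc.prems] .
  have "lam + (f ^^ Suc k) t = lam - 1 / (lam + (f ^^ k) t)" by (simp add: f_def)
  also have "\<dots> = lam - (sn k * t + sn (Suc k)) / (sn (Suc k) * t + sn (Suc (Suc k)))"
    using Suc by simp
  also have "\<dots> = (lam * (sn (Suc k) * t + sn (Suc (Suc k))) - (sn k * t + sn (Suc k)))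
      / (sn (Suc k) * t + sn (Suc (Suc k)))"
    using p by (simp add: diff_divide_distrib)
  finally show ?case by (simp add: sn_Suc_Suc[of k] sn_Suc_Suc[of "Suc k"] algebra_simps)
qed

lemma f_mono: "- lam < a \<Longrightarrow> a \<le> b \<Longrightarrow> f a \<le> f b"
  by (simp add: f_def frac_le)

lemma f_iter_mono:
  assumes "a \<le> b" "\<And>j. j < k \<Longrightarrow> - lam < (f ^^ j) a"
  shows "(f ^^ k) a \<le> (f ^^ k) b"
  using assms(2) by (induction k) (use assms(1) f_mono in auto)

lemma f_strict_mono: "- lam < a \<Longrightarrow> a < b \<Longrightarrow> f a < f b"
  by (simp add: f_def frac_less2)

lemma f_iter_strict_mono:
  assumes "a < b" "\<And>j. j < k \<Longrightarrow> - lam < (f ^^ j) a"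
  shows "(f ^^ k) a < (f ^^ k) b"
  using assms(2) by (induction k) (use assms(1) f_strict_mono in auto)

text \<open>After clearing the positive denominator, the bound says that \<open>?N\<close>, which is
  linear in \<open>t\<close>, is nonnegative; its coefficients are nonnegative by monotonicity and
  reflection of \<open>sn\<close>. The constant one vanishes exactly for \<open>q\<close> even and
  \<open>k = h\<close>, where strictness therefore needs \<open>t > 0\<close>.\<close>

lemma f_iter_lower:
  assumes "0 \<le> t" "k \<le> h"
  shows "- lam / 2 \<le> (f ^^ k) t"
    and "0 < t \<or> k < h \<or> odd q \<Longrightarrow> - lam / 2 < (f ^^ k) t"
proof -
  have kq: "Suc k < q" using assms two_h by linarith
  let ?D = "sn k * t + sn (Suc k)"
  let ?N = "t * (2 * sn (Suc k) - lam * sn k) + (sn (Suc (Suc k)) - sn k)"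
  have D: "?D > 0" using sn_den_pos[OF assms(1) kq] .
  have "?D * (lam + (f ^^ k) t) = sn (Suc k) * t + sn (Suc (Suc k))"
    using f_iter_closed[OF assms(1) kq] D by simp
  then have N: "?D * (2 * ((f ^^ k) t + lam / 2)) = ?N"
    by (simp add: algebra_simps sn_Suc_Suc)
  have t: "2 * sn (Suc k) - lam * sn k > 0"
  proof (cases k)
    case 0
    then show ?thesis using sn_pos[of 1] q_ge_3 by simp
  next
    case (Suc j)
    then have "sn j < sn (Suc k)" using sn_less[of j "Suc k"] assms two_h by simp
    then show ?thesis using sn_Suc_Suc[of j] Suc by simp
  qed
  have c: "sn (Suc (Suc k)) - sn k \<ge> 0"
    and c': "k < h \<or> odd q \<Longrightarrow> sn (Suc (Suc k)) - sn k > 0"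
  proof -
    consider "k < h" | "k = h" "odd q" | "k = h" "even q" using assms by linarith
    note cs = this
    from cs show "sn (Suc (Suc k)) - sn k \<ge> 0"
      by cases (use sn_less[of k "Suc (Suc k)"] sn_less[of h "Suc h"] two_h sn_odd sn_even in auto)
    from cs show "sn (Suc (Suc k)) - sn k > 0" if "k < h \<or> odd q"
      by cases (use that sn_less[of k "Suc (Suc k)"] sn_less[of h "Suc h"] two_h sn_odd in auto)
  qed
  have "?N \<ge> 0" using t c assms by simp
  then show "- lam / 2 \<le> (f ^^ k) t"
    using N D by (simp add: zero_le_mult_iff flip: N)
  assume "0 < t \<or> k < h \<or> odd q"
  then have "?N > 0" using t c c' assms
    by (metis add_nonneg_pos add_pos_nonneg less_imp_le mult_nonneg_nonneg mult_pos_pos)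
  then show "- lam / 2 < (f ^^ k) t"
    using N D by (simp add: zero_less_mult_iff flip: N)
qed

lemma f_iter_upper:
  assumes "0 \<le> t" "0 < k" "k \<le> Suc h"
  shows "(f ^^ k) t < 0"
proof -
  obtain j where k: "k = Suc j" using assms by (cases k) auto
  have "(f ^^ j) t \<ge> - lam / 2" using f_iter_lower(1)[of t j] assms k by simp
  then show ?thesis using lam_pos by (simp add: k f_def divide_less_0_iff)
qed

text \<open>The way the digit 1 leads to the end point \<open>- lam / 2\<close> decides which blocks
  are forbidden: from 0 in \<open>h\<close> steps for \<open>q\<close> even, from 1 in
  \<open>h + 1\<close> steps for \<open>q\<close> odd (\<open>odd_f_Suc_h_bounds\<close>).\<close>

lemma even_f_h_0: "even q \<Longrightarrow> (f ^^ h) 0 = - lam / 2"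
proof -
  assume e: "even q"
  have "sn h = lam / 2 * sn (Suc h)" using sn_Suc_Suc[of h] sn_even[OF e] by simp
  moreover have "sn (Suc h) > 0" using sn_pos[of "Suc h"] q_even[OF e] by simp
  moreover have "lam + (f ^^ h) 0 = sn h / sn (Suc h)"
    using f_iter_closed[of 0 h] q_even[OF e] sn_even[OF e] by simp
  ultimately have "lam + (f ^^ h) 0 = lam / 2" by simp
  then show ?thesis by simp
qed

lemma odd_f_h_0: "odd q \<Longrightarrow> (f ^^ h) 0 = 1 - lam"
  using f_iter_closed[of 0 h] q_odd sn_odd(1) sn_pos[of "Suc h"] by simp

lemma odd_f_Suc_h:
  assumes "odd q" "0 \<le> t"
  shows "lam + (f ^^ Suc h) t = (sn (Suc h) * t + sn h) / (sn (Suc h) * t + sn (Suc h))"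
  using f_iter_closed[of t "Suc h"] q_odd assms sn_odd by simp

lemma odd_sn: "odd q \<Longrightarrow> lam * sn (Suc h) = sn (Suc h) + sn h"
  using sn_Suc_Suc[of h] sn_odd(1) by simp

lemma odd_f_Suc_h_bounds:
  assumes "odd q"
  shows "(f ^^ Suc h) 1 = - lam / 2" "t > 1 \<Longrightarrow> - lam / 2 < (f ^^ Suc h) t"
proof -
  have p: "sn (Suc h) > 0" using sn_pos[of "Suc h"] q_odd assms by simp
  have "lam + (f ^^ Suc h) 1 = (lam * sn (Suc h)) / (2 * sn (Suc h))"
    using odd_f_Suc_h[of 1] odd_sn assms by simp
  then have "lam + (f ^^ Suc h) 1 = lam / 2" using p by simp
  then show 1: "(f ^^ Suc h) 1 = - lam / 2" by simp
  have "- lam < (f ^^ j) 1" if "j < Suc h" for j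
    using f_iter_lower(1)[of 1 j] that lam_pos by linarith
  then show "t > 1 \<Longrightarrow> - lam / 2 < (f ^^ Suc h) t"
    using f_iter_strict_mono[of 1 t "Suc h"] 1 by simp
qed

lemma odd_f_h_1: "odd q \<Longrightarrow> lam + (f ^^ h) 1 = 2 / lam"
proof -
  assume "odd q"
  then have "inverse (lam + (f ^^ h) 1) = lam / 2"
    using odd_f_Suc_h_bounds(1) by (simp add: f_def inverse_eq_divide)
  then have "lam + (f ^^ h) 1 = inverse (lam / 2)" by (metis inverse_inverse_eq)
  then show ?thesis by simp
qed

section \<open>Reciprocals, and the parametrisation of \<open>z\<close> by \<open>t\<close>\<close>

lemma moebius_inverse_arg:
  fixes t :: real
  assumes "t > 0"
  shows "(a * (1 / t) + b) / (c * (1 / t) + d) = (b * t + a) / (d * t + c)"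
proof -
  have "a * (1 / t) + b = (b * t + a) / t" "c * (1 / t) + d = (d * t + c) / t"
    using assms by (simp_all add: field_simps)
  then show ?thesis using assms by simp
qed

text \<open>Since \<open>sn (h + 2) = sn h\<close>, the closed form is
  \<open>(sn (h + 1) * t + sn h) / (sn h * t + sn (h + 1))\<close>, and \<open>1 / t\<close> in
  place of \<open>t\<close> exchanges numerator and denominator.\<close>

lemma even_flip:
  assumes "even q" "t > 0" "z = lam + (f ^^ h) t"
  shows "1 / z = lam + (f ^^ h) (1 / t)"
proof -
  have "lam + (f ^^ h) (1 / t) = (sn (Suc h) * (1 / t) + sn h) / (sn h * (1 / t) + sn (Suc h))"
    using assms sn_even q_even f_iter_closed[of "1 / t" h] by simp
  then show ?thesis
    unfolding moebius_inverse_arg[OF assms(2)]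
    using assms sn_even q_even f_iter_closed[of t h] by simp
qed

text \<open>Here no single iterate has the symmetry of the even case; the closed forms of the
  iterates \<open>h\<close> and \<open>h + 1\<close> are exchanged instead.\<close>

lemma odd_flip:
  assumes "odd q" "t > 0" "z = lam + (f ^^ h) t"
  shows "1 / z = lam + (f ^^ Suc h) (1 / t)"
proof -
  have "lam + (f ^^ Suc h) (1 / t)
      = (sn (Suc h) * (1 / t) + sn h) / (sn (Suc h) * (1 / t) + sn (Suc h))"
    using assms odd_f_Suc_h[of "1 / t"] by simp
  then show ?thesis
    unfolding moebius_inverse_arg[OF assms(2)]
    using assms sn_odd q_odd f_iter_closed[of t h] by simp
qed

text \<open>The bounds \<open>lam / 2\<close> and \<open>2 / lam\<close> are the values of the
  closed form at \<open>t = 0\<close> and at infinity.\<close>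

lemma even_split:
  assumes "even q" "lam / 2 < z" "z < 2 / lam"
  obtains t where "t > 0" "z = lam + (f ^^ h) t"
proof -
  have p: "sn (Suc h) > 0" "sn h > 0" using sn_pos[of "Suc h"] sn_pos[of h] q_even h_pos assms by auto
  have e: "2 * sn h = lam * sn (Suc h)" using sn_Suc_Suc[of h] sn_even assms by simp
  have l: "lam / 2 = sn h / sn (Suc h)" "2 / lam = sn (Suc h) / sn h"
    using p e lam_pos by (auto simp: field_simps)
  have n: "z * sn (Suc h) - sn h > 0" "sn (Suc h) - z * sn h > 0"
    using assms p unfolding l by (auto simp: field_simps)
  \<comment> \<open>Solution of the equation \<open>z = lam + (f ^^ h) t\<close>, which is linear in
    \<open>t\<close> after clearing denominators; the two bounds on \<open>z\<close> are the
    positivity of numerator and denominator.\<close>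
  define t where "t = (z * sn (Suc h) - sn h) / (sn (Suc h) - z * sn h)"
  have "t > 0" using n by (simp add: t_def)
  have "t * (sn (Suc h) - z * sn h) = z * sn (Suc h) - sn h"
    using n unfolding t_def by simp
  then have "z * (sn h * t + sn (Suc h)) = sn (Suc h) * t + sn h"
    by (simp add: algebra_simps)
  moreover have "sn h * t + sn (Suc h) > 0" using sn_den_pos[of t h] q_even assms \<open>t > 0\<close> by simp
  ultimately have "z = (sn (Suc h) * t + sn h) / (sn h * t + sn (Suc h))"
    by (simp add: nonzero_eq_divide_eq)
  then have "z = lam + (f ^^ h) t"
    using f_iter_closed[of t h] q_even assms sn_even \<open>t > 0\<close> by simp
  then show thesis using that \<open>t > 0\<close> by blast
qed

text \<open>The bounds 1 and \<open>2 / lam\<close> are the values at \<open>t = 0\<close> and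
  \<open>t = 1\<close>. Points below 1 are reached later through \<open>1 / z\<close>.\<close>

lemma odd_split:
  assumes "odd q" "1 < z" "z < 2 / lam"
  obtains t where "t > 0" "t < 1" "z = lam + (f ^^ h) t"
proof -
  have p: "sn (Suc h) > 0" "sn h \<ge> 0" "sn h < sn (Suc h)"
    using sn_pos[of "Suc h"] sn_pos[of h] sn_less[of h "Suc h"] two_h
    by (cases "h = 0"; simp)+
  have e: "lam * sn (Suc h) = sn (Suc h) + sn h" using odd_sn assms by simp
  have "z * lam < 2" using assms lam_pos by (simp add: field_simps)
  then have "z * (lam * sn (Suc h)) < 2 * sn (Suc h)"
    using p(1) by (metis mult.assoc mult_strict_right_mono)
  then have m: "z * (sn (Suc h) + sn h) < 2 * sn (Suc h)" using e by simp
  then have n: "(z - 1) * sn (Suc h) < sn (Suc h) - z * sn h" by (simp add: algebra_simps)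
  have n1: "(z - 1) * sn (Suc h) > 0" using assms p by simp
  define t where "t = (z - 1) * sn (Suc h) / (sn (Suc h) - z * sn h)"
  have t: "t > 0" "t < 1" using n n1 by (simp_all add: t_def)
  have "sn (Suc h) - z * sn h \<noteq> 0" using n n1 by linarith
  then have "t * (sn (Suc h) - z * sn h) = (z - 1) * sn (Suc h)"
    unfolding t_def by simp
  then have "z * (sn h * t + sn (Suc h)) = sn (Suc h) * t + sn (Suc h)"
    by (simp add: algebra_simps)
  moreover have "sn h * t + sn (Suc h) > 0" using sn_den_pos[of t h] q_odd assms t by simp
  ultimately have "z = (sn (Suc h) * t + sn (Suc h)) / (sn h * t + sn (Suc h))"
    by (simp add: nonzero_eq_divide_eq)
  then have "z = lam + (f ^^ h) t"
    using f_iter_closed[of t h] q_odd assms sn_odd t by simp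
  then show thesis using that t by blast
qed

section \<open>Forbidden blocks\<close>

text \<open>The value \<open>x n\<close> is left free: \<open>x n = 0\<close> describes a truncated
  expansion, while an orbit of the nearest-multiple map satisfies the relation for every
  \<open>n\<close>.\<close>

definition chain :: "(nat \<Rightarrow> int) \<Rightarrow> nat \<Rightarrow> (nat \<Rightarrow> real) \<Rightarrow> bool" where
  "chain b n x \<longleftrightarrow> (\<forall>l<n. x l = - 1 / (of_int (b l) * lam + x (Suc l)))"

lemma chainD: "chain b n x \<Longrightarrow> l < n \<Longrightarrow> x l = - 1 / (of_int (b l) * lam + x (Suc l))"
  by (simp add: chain_def)

lemma chain_uminus: "chain b n x \<Longrightarrow> chain (\<lambda>i. - b i) n (\<lambda>i. - x i)"
  unfolding chain_def
proof (intro allI impI)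
  fix l
  assume "\<forall>l<n. x l = - 1 / (of_int (b l) * lam + x (Suc l))" "l < n"
  moreover have "of_int (- b l) * lam + - x (Suc l) = - (of_int (b l) * lam + x (Suc l))" by simp
  ultimately show "- x l = - 1 / (of_int (- b l) * lam + - x (Suc l))"
    by (metis minus_divide_right)
qed

definition cf_apply :: "int list \<Rightarrow> real \<Rightarrow> real" where
  "cf_apply ds t = foldr (\<lambda>d t. - 1 / (of_int d * lam + t)) ds t"

lemma cf_apply_simps [simp]:
  "cf_apply [] t = t"
  "cf_apply (d # ds) t = - 1 / (of_int d * lam + cf_apply ds t)"
  "cf_apply (ds @ es) t = cf_apply ds (cf_apply es t)"
  by (simp_all add: cf_apply_def)

text \<open>As \<open>n\<close> grows with \<open>l\<close> fixed, these are the convergents of the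
  tail that starts at position \<open>l\<close>.\<close>

definition tail_val :: "(nat \<Rightarrow> int) \<Rightarrow> nat \<Rightarrow> nat \<Rightarrow> real" where
  "tail_val b n l = cf_apply (map b [l..<n]) 0"

lemma tail_val_ge [simp]: "n \<le> l \<Longrightarrow> tail_val b n l = 0"
  by (simp add: tail_val_def)

lemma tail_val_less: "l < n \<Longrightarrow> tail_val b n l = - 1 / (of_int (b l) * lam + tail_val b n (Suc l))"
  by (simp add: tail_val_def upt_conv_Cons)

lemma chain_tail_val: "chain b n (tail_val b n)"
  by (simp add: chain_def tail_val_less)

lemma lcf_value_Cons:
  "lcf_value q (d # ds) = of_int d * lam + cf_apply ds 0"
  by (induction ds arbitrary: d) auto

text \<open>Digit positions below are shifted by one against the paper: \<open>b i\<close> stands for \<open>a\<^sub>i\<^sub>+\<^sub>1\<close>,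
  and the case \<open>q = 3\<close> falls under the general odd case with \<open>h = 0\<close>.\<close>

definition pos_block :: "(nat \<Rightarrow> int) \<Rightarrow> nat \<Rightarrow> nat \<Rightarrow> bool" where
  "pos_block b l L \<longleftrightarrow>
    (if even q then L = l + h \<and> (\<forall>i<h. b (l + i) = 1) \<and> b (l + h) \<ge> 1
     else (L = l + h \<and> (\<forall>i<Suc h. b (l + i) = 1)) \<or>
       (L = l + h + Suc h \<and> (\<forall>i<h. b (l + i) = 1) \<and> b (l + h) = 2 \<and>
        (\<forall>i<h. b (Suc (l + h) + i) = 1) \<and> b (l + h + Suc h) \<ge> 1))"

lemma map_upt_replicate: "map b [l..<l + n] = replicate n c \<longleftrightarrow> (\<forall>i<n. b (l + i) = c)"
  by (auto simp: list_eq_iff_nth_eq)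

lemma upt_two_runs:
  "[l..<Suc (l + k + Suc k)] = [l..<l + k] @ [l + k] @ [Suc (l + k)..<Suc (l + k) + k] @ [l + k + Suc k]"
proof -
  have "[l..<Suc (l + k + Suc k)] = [l..<l + k + Suc k] @ [l + k + Suc k]"
    by (rule upt_Suc_append) simp
  also have "[l..<l + k + Suc k] = [l..<l + k] @ [l + k..<l + k + Suc k]"
    by (rule upt_add_eq_append) simp
  also have "[l + k..<l + k + Suc k] = (l + k) # [Suc (l + k)..<l + k + Suc k]"
    by (rule upt_conv_Cons) simp
  finally show ?thesis by simp
qed

lemma positive_forbidden_iff:
  assumes "l \<le> L"
  shows "map b [l..<Suc L] \<in> positive_forbidden_blocks q \<longleftrightarrow> pos_block b l L"
proof (cases "even q")
  case True
  have "q \<noteq> 3" using True by auto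
  \<comment> \<open>For \<open>q\<close> even the block of \<open>h + 1\<close> ones is the member
    \<open>m = 1\<close> of the other family.\<close>
  have "positive_forbidden_blocks q =
      insert (replicate h 1 @ [1]) {replicate h 1 @ [m] |m. m \<ge> 1}"
    using True \<open>q \<noteq> 3\<close> replicate_append_same[of h "1::int"]
    by (simp add: positive_forbidden_blocks_def Let_def)
  also have "\<dots> = {replicate h 1 @ [m] |m. m \<ge> 1}" by (intro insert_absorb) auto
  finally have "map b [l..<Suc L] \<in> positive_forbidden_blocks q \<longleftrightarrow>
      (\<exists>m\<ge>1. map b [l..<Suc L] = replicate h 1 @ [m])" (is "_ \<longleftrightarrow> ?P")
    by blast
  also have "?P \<longleftrightarrow> pos_block b l L"
  proof
    assume ?P
    then obtain m where m: "m \<ge> 1" "map b [l..<Suc L] = replicate h 1 @ [m]" by blast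
    have "length (map b [l..<Suc L]) = Suc h" unfolding m(2) by simp
    then have L: "L = l + h" using assms by simp
    have "map b [l..<l + h] = replicate h 1 \<and> b (l + h) = m" using m(2) L by simp
    then show "pos_block b l L" using True L m(1) by (simp add: pos_block_def map_upt_replicate)
  next
    assume "pos_block b l L"
    then show ?P using True
      by (intro exI[of _ "b (l + h)"]) (simp add: pos_block_def flip: map_upt_replicate)
  qed
  finally show ?thesis .
next
  case False
  have "map b [l..<Suc L] \<in> positive_forbidden_blocks q \<longleftrightarrow>
      map b [l..<Suc L] = replicate (Suc h) 1 \<or>
      (\<exists>m\<ge>1. map b [l..<Suc L] = replicate h 1 @ 2 # replicate h 1 @ [m])" (is "_ \<longleftrightarrow> ?P")
    using False h_eq_0 by (auto simp: positive_forbidden_blocks_def Let_def)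
  also have "?P \<longleftrightarrow> pos_block b l L"
  proof
    assume ?P
    then consider "map b [l..<Suc L] = replicate (Suc h) 1"
      | m where "m \<ge> 1" "map b [l..<Suc L] = replicate h 1 @ 2 # replicate h 1 @ [m]" by blast
    then show "pos_block b l L"
    proof cases
      case 1
      have "length (map b [l..<Suc L]) = Suc h" unfolding 1 by simp
      then have L: "L = l + h" using assms by simp
      have "map b [l..<l + Suc h] = replicate (Suc h) 1" using 1 L by simp
      then show ?thesis using False L unfolding map_upt_replicate by (simp add: pos_block_def)
    next
      case (2 m)
      have "length (map b [l..<Suc L]) = h + Suc (Suc h)" unfolding 2(2) by simp
      then have L: "L = l + h + Suc h" using assms by simp
      have "[l..<Suc L] = [l..<l + h] @ [l + h] @ [Suc (l + h)..<Suc (l + h) + h] @ [l + h + Suc h]"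
        unfolding L by (rule upt_two_runs)
      then have "map b [l..<l + h] = replicate h 1 \<and> b (l + h) = 2 \<and>
          map b [Suc (l + h)..<Suc (l + h) + h] = replicate h 1 \<and> b (l + h + Suc h) = m"
        using 2(2) by simp
      then show ?thesis using False L 2(1) unfolding map_upt_replicate by (simp add: pos_block_def)
    qed
  next
    assume p: "pos_block b l L"
    then consider "L = l + h" "\<forall>i<Suc h. b (l + i) = 1"
      | "L = l + h + Suc h" "\<forall>i<h. b (l + i) = 1" "b (l + h) = 2"
        "\<forall>i<h. b (Suc (l + h) + i) = 1" "b (l + h + Suc h) \<ge> 1"
      using False by (auto simp: pos_block_def)
    then show ?P
    proof cases
      case 1
      then show ?thesis unfolding map_upt_replicate[symmetric] by simp
    next
      case 2
      have "[l..<Suc L] = [l..<l + h] @ [l + h] @ [Suc (l + h)..<Suc (l + h) + h] @ [l + h + Suc h]"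
        unfolding 2(1) by (rule upt_two_runs)
      then show ?thesis using 2 unfolding map_upt_replicate[symmetric]
        by (intro disjI2 exI[of _ "b (l + h + Suc h)"]) simp
    qed
  qed
  finally show ?thesis .
qed

lemma forbidden_iff:
  assumes "l \<le> L"
  shows "map b [l..<Suc L] \<in> forbidden_blocks q \<longleftrightarrow> pos_block b l L \<or> pos_block (\<lambda>i. - b i) l L"
proof -
  have "xs \<in> map uminus ` P \<longleftrightarrow> map uminus xs \<in> P" for xs :: "int list" and P
    by (auto simp: image_iff o_def intro: bexI[of _ "map uminus xs"])
  then show ?thesis
    using positive_forbidden_iff[OF assms, of b] positive_forbidden_iff[OF assms, of "\<lambda>i. - b i"]
    by (simp add: forbidden_blocks_def o_def del: upt_Suc)
qed

text \<open>Regularity of an initial segment, in a form that serves finite and infinite expansions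
  alike.\<close>

definition admissible :: "(nat \<Rightarrow> int) \<Rightarrow> nat \<Rightarrow> bool" where
  "admissible b n \<longleftrightarrow> (\<forall>i<n. b i \<noteq> 0) \<and>
    (\<forall>l L. l \<le> L \<and> L < n \<longrightarrow> \<not> pos_block b l L \<and> \<not> pos_block (\<lambda>i. - b i) l L)"

section \<open>Values in [- lam / 2, lam / 2] rule out forbidden blocks\<close>

lemma chain_ones:
  assumes "chain b n x" "l + k \<le> n" "\<forall>i<k. b (l + i) = 1"
  shows "x l = (f ^^ k) (x (l + k))"
  using assms(2,3)
proof (induction k)
  case (Suc k)
  then have "x (l + k) = f (x (Suc (l + k)))"
    using chainD[OF assms(1), of "l + k"] by (simp add: f_def)
  then show ?case using Suc by (simp add: funpow_swap1)
qed simp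

lemma digit_mult: "c = of_int m * lam \<Longrightarrow> m \<le> d \<Longrightarrow> c \<le> of_int d * lam"
  using lam_pos by simp

lemma chain_run_less:
  assumes x: "chain b n x" and B: "\<And>i. i \<le> n \<Longrightarrow> \<bar>x i\<bar> \<le> lam / 2"
    and "l + k \<le> n" "\<forall>i<k. b (l + i) = 1" "x (l + k) < e"
  shows "x l < (f ^^ k) e"
proof -
  have "- lam < (f ^^ j) (x (l + k))" if "j < k" for j
  proof -
    have "b (l + (k - j) + i) = 1" if "i < j" for i
      using assms(4)[rule_format, of "k - j + i"] that \<open>j < k\<close> by (simp add: add.assoc)
    then have "x (l + (k - j)) = (f ^^ j) (x (l + (k - j) + j))"
      using that assms(3) by (intro chain_ones[OF x]) auto
    then have "(f ^^ j) (x (l + k)) = x (l + (k - j))" using that by simp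
    moreover have "\<bar>x (l + (k - j))\<bar> \<le> lam / 2" using assms(3) by (intro B) simp
    ultimately show ?thesis using lam_pos by linarith
  qed
  then show ?thesis using chain_ones[OF x assms(3,4)] f_iter_strict_mono assms(5) by simp
qed

text \<open>Each block would push \<open>x l\<close> below \<open>- lam / 2\<close>. For
  \<open>q\<close> even, the last digit makes the value after the ones negative, so
  \<open>x l < (f ^^ h) 0\<close>. For \<open>q\<close> odd, \<open>h + 1\<close> ones act on a
  value below 1, so \<open>x l < (f ^^ Suc h) 1\<close>; in the long block the second run gives a
  value below \<open>1 - lam\<close>, the digit 2 turns this into a value below \<open>f 1\<close>,
  and the first run leads to the same bound.\<close>

lemma chain_no_pos_block:
  assumes x: "chain b n x" and B: "\<And>i. i \<le> n \<Longrightarrow> \<bar>x i\<bar> \<le> lam / 2" and "L < n"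
  shows "\<not> pos_block b l L"
proof
  assume p: "pos_block b l L"
  have neg: "x i < 0" if "i < n" "b i \<ge> 1" for i
  proof -
    have "of_int (b i) * lam + x (Suc i) > 0"
      using digit_mult[OF _ that(2), of lam] B[of "Suc i"] that(1) lam_pos by linarith
    then show ?thesis using chainD[OF x that(1)] by (simp add: divide_less_0_iff)
  qed
  have low: "l \<le> n \<Longrightarrow> - lam / 2 \<le> x l" using B[of l] by linarith
  consider "even q" "L = l + h" "\<forall>i<h. b (l + i) = 1" "b (l + h) \<ge> 1"
    | "odd q" "L = l + h" "\<forall>i<Suc h. b (l + i) = 1"
    | "odd q" "L = l + h + Suc h" "\<forall>i<h. b (l + i) = 1" "b (l + h) = 2"
        "\<forall>i<h. b (Suc (l + h) + i) = 1" "b (l + h + Suc h) \<ge> 1"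
    using p by (auto simp: pos_block_def split: if_splits)
  then show False
  proof cases
    case 1
    have "x l < (f ^^ h) 0"
      using 1 assms(3) by (intro chain_run_less[OF x B] neg) auto
    then show False using even_f_h_0 1 low assms(3) by simp
  next
    case 2
    have "x (l + Suc h) < 1" using B[of "l + Suc h"] 2 assms(3) lam_less_2 by simp
    then have "x l < (f ^^ Suc h) 1"
      using 2 assms(3) by (intro chain_run_less[OF x B]) auto
    then show False using odd_f_Suc_h_bounds 2 low assms(3) by simp
  next
    case 3
    have "x (Suc (l + h)) < (f ^^ h) 0"
      using 3 assms(3) by (intro chain_run_less[OF x B] neg) auto
    then have a: "x (Suc (l + h)) < 1 - lam" using odd_f_h_0 3 by simp
    have "2 * lam + x (Suc (l + h)) > 0" using B[of "Suc (l + h)"] 3 assms(3) lam_pos by simp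
    then have "x (l + h) < f 1"
      using chainD[OF x, of "l + h"] 3 assms(3) a by (simp add: f_def frac_less2)
    then have "x l < (f ^^ h) (f 1)"
      using 3 assms(3) by (intro chain_run_less[OF x B]) auto
    then show False using odd_f_Suc_h_bounds(1) 3 low assms(3) by (simp add: funpow_swap1)
  qed
qed

text \<open>A zero digit would give two consecutive values with product - 1, but both are at most
  \<open>lam / 2 < 1\<close> in absolute value.\<close>

lemma chain_digit_nonzero:
  assumes "chain b n x" "\<And>i. i \<le> n \<Longrightarrow> \<bar>x i\<bar> \<le> lam / 2" "i < n" "x i \<noteq> 0"
  shows "b i \<noteq> 0"
proof
  assume "b i = 0"
  then have "x i * x (Suc i) = - 1" using chainD[OF assms(1,3)] assms(4) by (auto simp: field_simps)
  then have "\<bar>x i\<bar> * \<bar>x (Suc i)\<bar> = 1" by (metis abs_minus_cancel abs_mult abs_one)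
  moreover have "\<bar>x i\<bar> * \<bar>x (Suc i)\<bar> \<le> (lam / 2) * (lam / 2)"
    using assms(2)[of i] assms(2)[of "Suc i"] assms(3) by (intro mult_mono) auto
  moreover have "(lam / 2) * (lam / 2) < 1 * 1"
    using lam_pos lam_less_2 by (intro mult_strict_mono) auto
  ultimately show False by simp
qed

lemma chain_admissible:
  assumes "chain b n x" "\<And>i. i \<le> n \<Longrightarrow> \<bar>x i\<bar> \<le> lam / 2" "\<And>i. i < n \<Longrightarrow> x i \<noteq> 0"
  shows "admissible b n"
  unfolding admissible_def
  using chain_no_pos_block[OF assms(1,2)] chain_no_pos_block[OF chain_uminus[OF assms(1)]] assms(2)
    chain_digit_nonzero[OF assms(1,2)] assms(3) by auto

section \<open>Admissible digits force values into [- lam / 2, lam / 2]\<close>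

lemma f_iter_0_antimono: "k \<le> h \<Longrightarrow> (f ^^ h) 0 \<le> (f ^^ k) 0"
proof -
  assume k: "k \<le> h"
  have e: "(f ^^ j) ((f ^^ (h - k)) 0) = (f ^^ (j + (h - k))) 0" for j by (simp add: funpow_add)
  have "- lam < (f ^^ j) ((f ^^ (h - k)) 0)" if "j < k" for j
    using f_iter_lower(1)[of 0 "j + (h - k)"] that k lam_pos unfolding e by linarith
  moreover have "(f ^^ (h - k)) 0 \<le> 0"
    using f_iter_upper[of 0 "h - k"] k le_SucI[OF diff_le_self[of h k]]
    by (cases "h = k") (auto intro: less_imp_le)
  ultimately have "(f ^^ k) ((f ^^ (h - k)) 0) \<le> (f ^^ k) 0" by (intro f_iter_mono)
  then show ?thesis using k unfolding e by simp
qed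

lemma obtain_run:
  fixes l n :: nat
  assumes "l \<le> n"
  obtains k where "l + k \<le> n" "\<forall>i<k. b (l + i) = (1::int)" "l + k = n \<or> b (l + k) \<noteq> 1"
proof -
  let ?P = "\<lambda>k. l + k = n \<or> b (l + k) \<noteq> 1"
  have ex: "?P (n - l)" using assms by simp
  show thesis
  proof (rule that[of "LEAST k. ?P k"])
    show "l + (LEAST k. ?P k) \<le> n" using Least_le[of ?P, OF ex] assms by simp
    show "\<forall>i<LEAST k. ?P k. b (l + i) = 1" using not_less_Least[of _ ?P] by blast
    show "?P (LEAST k. ?P k)" using LeastI[of ?P, OF ex] .
  qed
qed

text \<open>If the digit after the run is at least 2, then \<open>k < h\<close>, the value there is
  at least \<open>f 0\<close>, and \<open>y l\<close> is at least \<open>(f ^^ Suc k) 0\<close>. If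
  it is negative or the expansion ends, the value there is nonnegative and \<open>y l\<close> is at
  least \<open>(f ^^ k) 0\<close>. Both are bounded below by \<open>(f ^^ h) 0\<close>.\<close>

lemma chain_run_bound:
  assumes y: "chain b n y" "y n = 0" and B: "\<And>i. l < i \<Longrightarrow> i \<le> n \<Longrightarrow> \<bar>y i\<bar> \<le> lam / 2"
    and k: "l + k \<le> n" "\<forall>i<k. b (l + i) = 1" "l + k = n \<or> b (l + k) \<noteq> 1" "k \<le> h"
    and nz: "l + k < n \<Longrightarrow> b (l + k) \<noteq> 0"
    and last: "k = h \<Longrightarrow> l + k < n \<Longrightarrow> b (l + k) < 1"
  shows "(f ^^ h) 0 \<le> y l"
proof -
  have yl: "y l = (f ^^ k) (y (l + k))" by (rule chain_ones[OF y(1) k(1,2)])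
  show ?thesis
  proof (cases "l + k < n \<and> b (l + k) \<ge> 2")
    case True
    then have kh: "k < h" using k last by (cases "k = h") auto
    have "lam \<le> of_int (b (l + k)) * lam + y (Suc (l + k))"
      using digit_mult[of "2 * lam" 2 "b (l + k)"] B[of "Suc (l + k)"] True lam_pos by linarith
    then have "f 0 \<le> y (l + k)"
      using chainD[OF y(1), of "l + k"] True lam_pos by (simp add: f_def frac_le)
    moreover have "- lam < (f ^^ j) (f 0)" if "j < k" for j
      using f_iter_lower(1)[of 0 "Suc j"] that kh lam_pos by (simp add: funpow_swap1)
    ultimately have "(f ^^ Suc k) 0 \<le> y l"
      using f_iter_mono[of "f 0" "y (l + k)" k] yl by (simp add: funpow_swap1)
    then show ?thesis using f_iter_0_antimono[of "Suc k"] kh by simp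
  next
    case False
    have "0 \<le> y (l + k)"
    proof (cases "l + k < n")
      case True
      then have "b (l + k) \<le> - 1" using k(3) nz False by linarith
      then have "of_int (b (l + k)) * lam + y (Suc (l + k)) \<le> 0"
        using digit_mult[of _ "b (l + k)" "- 1"] B[of "Suc (l + k)"] True lam_pos by force
      then show ?thesis using chainD[OF y(1) True] by (simp add: divide_nonpos_nonpos)
    qed (use k y in simp)
    moreover have "- lam < (f ^^ j) 0" if "j < k" for j
      using f_iter_lower(1)[of 0 j] that k lam_pos by simp
    ultimately have "(f ^^ k) 0 \<le> y l" using f_iter_mono[of 0 "y (l + k)" k] yl by simp
    then show ?thesis using f_iter_0_antimono[OF k(4)] by simp
  qed
qed

text \<open>By \<open>chain_run_bound\<close>, the critical case is a run of \<open>h\<close> ones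
  followed by a positive digit, which leaves only \<open>q\<close> odd and a digit at least 2. It
  then suffices that the value at \<open>l + h\<close> is at least \<open>f 1\<close>, because
  \<open>(f ^^ Suc h) 1 = - lam / 2\<close>.\<close>

lemma chain_lower:
  assumes y: "chain b n y" "y n = 0" and B: "\<And>i. l < i \<Longrightarrow> i \<le> n \<Longrightarrow> \<bar>y i\<bar> \<le> lam / 2"
    and l: "l \<le> n" and nz: "\<And>i. i < n \<Longrightarrow> b i \<noteq> 0" and nb: "\<And>l L. L < n \<Longrightarrow> \<not> pos_block b l L"
  shows "- lam / 2 \<le> y l"
proof -
  have h0: "- lam / 2 \<le> (f ^^ h) 0" by (rule f_iter_lower(1)) simp_all
  obtain k where k: "l + k \<le> n" "\<forall>i<k. b (l + i) = 1" "l + k = n \<or> b (l + k) \<noteq> 1"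
    using obtain_run[OF l] by metis
  have ones: "k' \<le> h" if "l' + k' \<le> n" "\<forall>i<k'. b (l' + i) = 1" for l' k'
  proof (rule ccontr)
    assume "\<not> k' \<le> h"
    then have "\<not> pos_block b l' (l' + h)" "h < k'" using nb[of "l' + h" l'] that by auto
    then show False using that by (cases "even q") (auto simp: pos_block_def)
  qed
  show ?thesis
  proof (cases "k = h \<and> l + k < n \<and> b (l + k) \<ge> 1")
    case False
    then have "(f ^^ h) 0 \<le> y l"
      using ones k nz by (intro chain_run_bound[OF y B k]) auto
    then show ?thesis using h0 by simp
  next
    case True
    then have odd: "odd q" using nb[of "l + h" l] k by (auto simp: pos_block_def)
    have b2: "b (l + h) \<ge> 2" using True k by auto
    have "f 1 \<le> y (l + h)"
    proof (cases "b (l + h) = 2")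
      case False
      \<comment> \<open>A digit at least 3 leaves at least \<open>3 * lam - lam / 2\<close>, and
        \<open>lam\<close> is at least 1.\<close>
      then have "lam + 1 \<le> of_int (b (l + h)) * lam + y (Suc (l + h))"
        using digit_mult[of "3 * lam" 3 "b (l + h)"] B[of "Suc (l + h)"] True b2 lam_ge_1
        by linarith
      then show ?thesis
        using chainD[OF y(1), of "l + h"] True lam_pos by (simp add: f_def frac_le)
    next
      case 2: True
      obtain j where j: "Suc (l + h) + j \<le> n" "\<forall>i<j. b (Suc (l + h) + i) = 1"
        "Suc (l + h) + j = n \<or> b (Suc (l + h) + j) \<noteq> 1"
        using obtain_run[of "Suc (l + h)" n b] True by auto
      \<comment> \<open>After the digit 2 the long forbidden block excludes the critical
        continuation, so the bound for ordinary runs applies and equals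
        \<open>1 - lam\<close>.\<close>
      have "(f ^^ h) 0 \<le> y (Suc (l + h))"
      proof (rule chain_run_bound[OF y B j])
        show "j \<le> h" using ones j by blast
        show "b (Suc (l + h) + j) < 1" if "j = h" "Suc (l + h) + j < n"
          using nb[of "l + h + Suc h" l] that k j 2 True odd
          by (auto simp: pos_block_def)
      qed (use nz in auto)
      then have "lam + 1 \<le> 2 * lam + y (Suc (l + h))" using odd_f_h_0[OF odd] by simp
      then show ?thesis
        using chainD[OF y(1), of "l + h"] True 2 lam_pos by (simp add: f_def frac_le)
    qed
    moreover have "- lam < (f ^^ j) (f 1)" if "j < h" for j
      using f_iter_lower(1)[of 1 "Suc j"] that lam_pos by (simp add: funpow_swap1)
    ultimately have "(f ^^ Suc h) 1 \<le> y l"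
      using f_iter_mono[of "f 1" "y (l + h)" h] chain_ones[OF y(1) k(1,2)] True
      by (simp add: funpow_swap1)
    then show ?thesis using odd_f_Suc_h_bounds(1)[OF odd] by simp
  qed
qed

text \<open>Induction from the end of the expansion; the upper bound is the lower bound for the
  negated digits.\<close>

lemma admissible_bound:
  assumes "admissible b n" "l \<le> n"
  shows "\<bar>tail_val b n l\<bar> \<le> lam / 2"
  using assms(2)
proof (induction "n - l" arbitrary: l rule: less_induct)
  case (less l)
  have *: "\<bar>tail_val b n i\<bar> \<le> lam / 2" if "l < i" "i \<le> n" for i
    using that by (intro less.hyps) auto
  have "l' \<le> L" if "pos_block c l' L" for c l' L
    using that by (auto simp: pos_block_def split: if_splits)
  then have nb: "\<not> pos_block b l' L" "\<not> pos_block (\<lambda>i. - b i) l' L" if "L < n" for l' L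
    using assms(1) that unfolding admissible_def by blast+
  have "- lam / 2 \<le> tail_val b n l"
    by (rule chain_lower[OF chain_tail_val _ *]) (use assms less.prems nb in \<open>auto simp: admissible_def\<close>)
  moreover have "- lam / 2 \<le> - tail_val b n l"
    by (rule chain_lower[OF chain_uminus[OF chain_tail_val]])
      (use assms less.prems nb * in \<open>auto simp: admissible_def\<close>)
  ultimately show ?case by linarith
qed

section \<open>Values of regular expansions\<close>

text \<open>A common reformulation for both notions of regularity. The digit at index 0 is exempt,
  hence \<open>N - 1\<close>; for \<open>N = 0\<close> both sides are vacuous.\<close>

lemma admissible_shift:
  "admissible (\<lambda>i. a (Suc i)) (N - 1) \<longleftrightarrow> (\<forall>i. 1 \<le> i \<and> i < N \<longrightarrow> a i \<noteq> 0) \<and>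
    (\<forall>l L. 1 \<le> l \<and> l \<le> L \<and> L < N \<longrightarrow> map a [l..<Suc L] \<notin> forbidden_blocks q)"
proof -
  have m: "map a [Suc l..<Suc (Suc L)] = map (\<lambda>i. a (Suc i)) [l..<Suc L]" for l L
    by (subst map_Suc_upt[symmetric]) (simp only: map_map o_def)
  have P: "(\<forall>i. 1 \<le> i \<and> i < N \<longrightarrow> P i) \<longleftrightarrow> (\<forall>i<N - 1. P (Suc i))" for P
    by (auto simp: less_diff_conv) (metis Suc_le_D Suc_le_eq less_SucE not0_implies_Suc not_less_eq)
  have Q: "(\<forall>l L. 1 \<le> l \<and> l \<le> L \<and> L < N \<longrightarrow> P l L) \<longleftrightarrow>
      (\<forall>l L. l \<le> L \<and> L < N - 1 \<longrightarrow> P (Suc l) (Suc L))" (is "?A \<longleftrightarrow> ?B") for P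
  proof
    assume ?B
    show ?A
    proof (intro allI impI)
      fix l L assume "1 \<le> l \<and> l \<le> L \<and> L < N"
      then have "l - 1 \<le> L - 1 \<and> L - 1 < N - 1" "Suc (l - 1) = l" "Suc (L - 1) = L" by auto
      then show "P l L" using \<open>?B\<close> by metis
    qed
  qed auto
  show ?thesis unfolding P Q m admissible_def
    by (intro arg_cong2[of _ _ _ _ "(\<and>)"] refl iff_allI imp_cong)
      (simp add: forbidden_iff del: upt_Suc)
qed

lemma regular_infinite_iff: "regular_infinite q a \<longleftrightarrow> (\<forall>n. admissible (\<lambda>i. a (Suc i)) n)"
proof -
  have "regular_infinite q a \<longleftrightarrow> (\<forall>N. admissible (\<lambda>i. a (Suc i)) (N - 1))"
    unfolding regular_infinite_def admissible_shift by (meson lessI)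
  also have "\<dots> \<longleftrightarrow> (\<forall>n. admissible (\<lambda>i. a (Suc i)) n)" by (metis diff_Suc_1)
  finally show ?thesis .
qed

lemma regular_finite_iff:
  "regular_finite q as \<longleftrightarrow> as \<noteq> [] \<and> admissible (\<lambda>i. as ! Suc i) (length as - 1)"
  unfolding regular_finite_def admissible_shift by blast

lemma lcf_value_map: "lcf_value q (map a [0..<Suc n]) = of_int (a 0) * lam + tail_val (\<lambda>i. a (Suc i)) n 0"
proof -
  have "map a [0..<Suc n] = a 0 # map (\<lambda>i. a (Suc i)) [0..<n]"
    by (subst upt_conv_Cons) (simp_all add: o_def del: upt_Suc flip: map_Suc_upt)
  then show ?thesis by (simp only: lcf_value_Cons tail_val_def)
qed

lemma lcf_convergent_eq:
  "lcf_convergent q a n = of_int (a 0) * lam + tail_val (\<lambda>i. a (Suc i)) n 0"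
  unfolding lcf_convergent_def by (rule lcf_value_map)

lemma lcf_value_eq:
  assumes "as \<noteq> []"
  shows "lcf_value q as = of_int (as ! 0) * lam + tail_val (\<lambda>i. as ! Suc i) (length as - 1) 0"
proof -
  have "as = map ((!) as) [0..<Suc (length as - 1)]" using assms by (simp add: map_nth del: upt_Suc)
  then show ?thesis by (metis lcf_value_map)
qed

lemma digit_plus_bound:
  assumes "(d::int) \<noteq> 0" "\<bar>t\<bar> \<le> lam / 2"
  shows "lam / 2 \<le> \<bar>of_int d * lam + t\<bar>"
proof -
  have "1 * lam \<le> \<bar>of_int d\<bar> * lam" using assms(1) lam_pos by (intro mult_right_mono) linarith+
  then have "lam \<le> \<bar>of_int d * lam\<bar>" using lam_pos by (simp add: abs_mult)
  then show ?thesis using assms(2) by linarith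
qed

text \<open>The denominator is at least \<open>lam / 2\<close> in absolute value, so on admissible
  digits the convention \<open>x / 0 = 0\<close> never takes effect.\<close>

lemma tail_val_nonzero: "admissible b n \<Longrightarrow> l < n \<Longrightarrow> tail_val b n l \<noteq> 0"
  using digit_plus_bound[of "b l" "tail_val b n (Suc l)"] admissible_bound[of b n "Suc l"] lam_pos
  by (auto simp: tail_val_less admissible_def)

lemma tail_val_eq_chain:
  assumes "chain b n x" "x n = 0" "l \<le> n"
  shows "tail_val b n l = x l"
  using assms(3) by (induction l rule: inc_induct) (use assms chainD in \<open>auto simp: tail_val_less\<close>)

lemma finite_expansion_of_chain:
  assumes "chain b n x" "\<And>i. i \<le> n \<Longrightarrow> \<bar>x i\<bar> \<le> lam / 2" "\<And>i. i < n \<Longrightarrow> x i \<noteq> 0" "x n = 0"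
  shows "finite_reg_expansion q (map (case_nat d b) [0..<Suc n]) (of_int d * lam + x 0)"
proof -
  have a: "admissible b n" by (rule chain_admissible) (use assms in auto)
  have "admissible (\<lambda>i. map (case_nat d b) [0..<Suc n] ! Suc i) n \<longleftrightarrow> admissible b n"
  proof -
    have "\<forall>i<n. map (case_nat d b) [0..<Suc n] ! Suc i = b i" by (simp del: upt_Suc)
    then show ?thesis
      unfolding admissible_def pos_block_def by (intro arg_cong2[of _ _ _ _ "(\<and>)"] iff_allI imp_cong refl) auto
  qed
  then show ?thesis unfolding finite_reg_expansion_def regular_finite_iff lcf_value_map
    using a tail_val_eq_chain[OF assms(1,4)] by (simp del: upt_Suc)
qed

text \<open>The difference of \<open>- 1 / X\<close> and \<open>- 1 / Y\<close> is their product
  times \<open>X - Y\<close>, and both factors are at most \<open>lam / 2\<close> in absolute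
  value.\<close>

lemma chain_contraction:
  assumes "chain b n x" "\<And>i. i \<le> n \<Longrightarrow> \<bar>x i\<bar> \<le> lam / 2" "\<And>i. i < n \<Longrightarrow> x i \<noteq> 0" "l \<le> n"
  shows "\<bar>x l - tail_val b n l\<bar> \<le> (lam / 2 * (lam / 2)) ^ (n - l)"
  using assms(4)
proof (induction l rule: inc_induct)
  case base
  then show ?case using assms(2)[of n] lam_less_2 by simp
next
  case (step l)
  define X where "X = of_int (b l) * lam + x (Suc l)"
  define Y where "Y = of_int (b l) * lam + tail_val b n (Suc l)"
  have a: "admissible b n" by (rule chain_admissible) (use assms in auto)
  have x: "x l = - 1 / X" using chainD[OF assms(1) step(2)] X_def by simp
  have y: "tail_val b n l = - 1 / Y" using tail_val_less step(2) Y_def by simp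
  have "X \<noteq> 0" "Y \<noteq> 0"
    using x y assms(3)[OF step(2)] tail_val_nonzero[OF a step(2)] by auto
  then have "x l - tail_val b n l = x l * tail_val b n l * (X - Y)"
    unfolding x y by (simp add: field_simps)
  then have "\<bar>x l - tail_val b n l\<bar> = \<bar>x l\<bar> * \<bar>tail_val b n l\<bar> * \<bar>x (Suc l) - tail_val b n (Suc l)\<bar>"
    by (simp add: abs_mult X_def Y_def)
  also have "\<dots> \<le> lam / 2 * (lam / 2) * (lam / 2 * (lam / 2)) ^ (n - Suc l)"
    using assms(2)[of l] step admissible_bound[OF a, of l] by (intro mult_mono) auto
  also have "\<dots> = (lam / 2 * (lam / 2)) ^ (n - l)"
    using step(2) by (simp add: Suc_diff_Suc flip: power_Suc)
  finally show ?case .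
qed

lemma infinite_expansion_of_chain:
  assumes "\<And>n. chain (\<lambda>i. a (Suc i)) n x" "\<And>i. \<bar>x i\<bar> \<le> lam / 2" "\<And>i. x i \<noteq> 0"
  shows "infinite_reg_expansion q a (of_int (a 0) * lam + x 0)"
proof -
  let ?t = "\<lambda>n. tail_val (\<lambda>i. a (Suc i)) n 0"
  have "regular_infinite q a"
    unfolding regular_infinite_iff using chain_admissible[OF assms(1)] assms by blast
  moreover have "(\<lambda>n. x 0 - ?t n) \<longlonglongrightarrow> 0"
  proof (rule Lim_null_comparison)
    show "\<forall>\<^sub>F n in sequentially. norm (x 0 - ?t n) \<le> (lam / 2 * (lam / 2)) ^ n"
      using chain_contraction[OF assms(1), of _ 0] assms by (intro always_eventually) simp
    have "lam / 2 * (lam / 2) < 1 * 1"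
      using lam_pos lam_less_2 by (intro mult_strict_mono) auto
    then show "(\<lambda>n. (lam / 2 * (lam / 2)) ^ n) \<longlonglongrightarrow> 0"
      by (intro LIMSEQ_realpow_zero) (use lam_pos in auto)
  qed
  then have "(\<lambda>n. of_int (a 0) * lam + x 0 - (x 0 - ?t n)) \<longlonglongrightarrow> of_int (a 0) * lam + x 0 - 0"
    by (intro tendsto_intros)
  ultimately show ?thesis
    by (simp add: infinite_reg_expansion_def lcf_convergent_eq[abs_def])
qed

section \<open>Orbits of the nearest-multiple map\<close>

text \<open>Ties are rounded up, so the remainder \<open>red\<close> lies in the half-open interval
  [- lam / 2, lam / 2).\<close>

definition near :: "real \<Rightarrow> int" where "near x = \<lfloor>x / lam + 1 / 2\<rfloor>"

definition red :: "real \<Rightarrow> real" where "red x = x - of_int (near x) * lam"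

text \<open>Since \<open>- 1 / 0 = 0\<close>, an orbit that reaches 0 stays there; these are the
  points that receive a finite expansion.\<close>

definition orb :: "nat \<Rightarrow> real \<Rightarrow> real" where "orb n x = ((\<lambda>x. red (- 1 / x)) ^^ n) (red x)"

text \<open>Stand-in for having a common tail. \<open>reg_equiv\<close> quantifies over all
  expansions of a point, whereas the orbit is unique, so transitivity is immediate here.\<close>

definition merge :: "real \<Rightarrow> real \<Rightarrow> bool" where "merge x y \<longleftrightarrow> (\<exists>m n. orb m x = orb n y)"

lemma red_bounds: "- lam / 2 \<le> red x" "red x < lam / 2"
proof -
  have "of_int (near x) - 1 / 2 \<le> x / lam" "x / lam < of_int (near x) + 1 / 2"
    unfolding near_def by linarith+
  then show "- lam / 2 \<le> red x" "red x < lam / 2"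
    unfolding pos_le_divide_eq[OF lam_pos] pos_divide_less_eq[OF lam_pos] red_def
    by (auto simp: algebra_simps)
qed

lemma near_eq_0: "- lam / 2 \<le> x \<Longrightarrow> x < lam / 2 \<Longrightarrow> near x = 0"
  using lam_pos by (auto simp: near_def field_simps intro!: floor_unique)

lemma red_id: "- lam / 2 \<le> x \<Longrightarrow> x < lam / 2 \<Longrightarrow> red x = x"
  by (simp add: red_def near_eq_0)

lemma red_add: "red (x + of_int n * lam) = red x"
proof -
  have "(x + of_int n * lam) / lam + 1 / 2 = x / lam + 1 / 2 + of_int n"
    using lam_pos by (simp add: field_simps)
  then have "near (x + of_int n * lam) = near x + n" unfolding near_def by (metis floor_add_int)
  then show ?thesis by (simp add: red_def algebra_simps)
qed

lemma orb_0: "orb 0 x = red x" by (simp add: orb_def)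

lemma orb_Suc: "orb (Suc n) x = red (- 1 / orb n x)" by (simp add: orb_def)

lemma orb_add: "orb m x = orb n y \<Longrightarrow> orb (m + k) x = orb (n + k) y"
  by (induction k) (auto simp: orb_Suc)

lemma orb_bound: "\<bar>orb n x\<bar> \<le> lam / 2"
  using red_bounds[of x] red_bounds[of "- 1 / orb (n - 1) x"] orb_0[of x] orb_Suc[of "n - 1" x]
  by (cases n) (auto simp: abs_le_iff)

lemma merge_refl [simp]: "merge x x" by (auto simp: merge_def)

lemma merge_sym: "merge x y \<Longrightarrow> merge y x" unfolding merge_def by metis

lemma merge_trans [trans]: "merge x y \<Longrightarrow> merge y z \<Longrightarrow> merge x z"
proof -
  assume "merge x y" "merge y z"
  then obtain m n m' n' where "orb m x = orb n y" "orb m' y = orb n' z" unfolding merge_def by blast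
  then have "orb (m + m') x = orb (n' + n) z"
    using orb_add[of m x n y m'] orb_add[of m' y n' z n] by (simp add: add.commute)
  then show ?thesis unfolding merge_def by blast
qed

lemma merge_add: "merge x (x + of_int n * lam)"
  unfolding merge_def orb_def by (metis red_add)

lemma merge_add_lam: "merge x (lam + x)" "merge x (x - lam)"
  using merge_add[of x 1] merge_add[of x "- 1"] by (auto simp: add.commute)

lemma merge_inv: "- lam / 2 \<le> x \<Longrightarrow> x < lam / 2 \<Longrightarrow> merge x (- 1 / x)"
  unfolding merge_def by (rule exI[of _ 1], rule exI[of _ 0]) (simp add: orb_0 orb_Suc red_id)

section \<open>Expansions read off from orbits\<close>

definition dig :: "real \<Rightarrow> nat \<Rightarrow> int" where "dig x l = near (- 1 / orb l x)"

lemma chain_orb: "chain (dig x) n (\<lambda>l. orb l x)"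
proof -
  have "of_int (dig x l) * lam + orb (Suc l) x = - 1 / orb l x" for l
    by (simp add: dig_def orb_Suc red_def)
  then show ?thesis by (simp add: chain_def)
qed

lemma near_orb: "of_int (near x) * lam + orb 0 x = x"
  by (simp add: orb_0 red_def)

lemma orb_zero: "orb n x = 0 \<Longrightarrow> orb (n + k) x = 0"
  using red_id[of 0] lam_pos by (induction k) (auto simp: orb_Suc)

lemma finite_expansion_of_orb:
  assumes "orb n x = 0"
  shows "\<exists>as. finite_reg_expansion q as x"
proof -
  \<comment> \<open>The expansion must stop at the first zero, since the digits after it would be
    0.\<close>
  define N where "N = (LEAST n. orb n x = 0)"
  have "orb N x = 0" unfolding N_def using assms by (rule LeastI)
  moreover have "orb i x \<noteq> 0" if "i < N" for i using not_less_Least that N_def by metis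
  ultimately show ?thesis
    using finite_expansion_of_chain[OF chain_orb orb_bound, of N x "near x"] near_orb by metis
qed

lemma infinite_expansion_of_orb:
  assumes "\<And>n. orb n x \<noteq> 0"
  shows "infinite_reg_expansion q (case_nat (near x) (dig x)) x"
  using infinite_expansion_of_chain[of "case_nat (near x) (dig x)" "\<lambda>l. orb l x"]
    chain_orb orb_bound assms near_orb by simp

text \<open>Orbits that meet stay together: either both reach 0, or neither does and the digits
  agree from the meeting point on.\<close>

lemma merge_imp_reg_equiv:
  assumes "merge x y"
  shows "reg_equiv q x y"
proof -
  obtain m n where mn: "orb m x = orb n y" using assms by (auto simp: merge_def)
  show ?thesis
  proof (cases "\<exists>k. orb k x = 0")
    case True
    then obtain k where k: "orb k x = 0" by blast
    then have "orb (m + k) x = 0" using orb_zero[of k x m] by (simp add: add.commute)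
    then have "orb (n + k) y = 0" using orb_add[OF mn] by simp
    then show ?thesis using k finite_expansion_of_orb unfolding reg_equiv_def by blast
  next
    case False
    moreover have "orb k y \<noteq> 0" for k
    proof
      assume "orb k y = 0"
      then have "orb (n + k) y = 0" using orb_zero[of k y n] by (simp add: add.commute)
      then show False using orb_add[OF mn, of k] False by metis
    qed
    moreover have "case_nat (near x) (dig x) (Suc m + k) = case_nat (near y) (dig y) (Suc n + k)" for k
      using orb_add[OF mn, of k] by (simp add: dig_def)
    ultimately show ?thesis using infinite_expansion_of_orb unfolding reg_equiv_def by blast
  qed
qed

section \<open>The point \<open>r\<^sub>q\<close>\<close>

text \<open>\<open>w k\<close> is the tail at the start of period number \<open>k\<close>. These
  tails are not assumed equal, since the comparison of \<open>z\<close> with \<open>- 1 / z\<close>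
  produces a sequence of points; convergence identifies \<open>w 0\<close> afterwards.\<close>

lemma infinite_expansion_periodic:
  assumes "ps \<noteq> []" and w: "\<And>k. w k = cf_apply ps (w (Suc k))"
    and B: "\<And>j k. j < length ps \<Longrightarrow>
      - lam / 2 \<le> cf_apply (drop j ps) (w (Suc k)) \<and> cf_apply (drop j ps) (w (Suc k)) < 0"
  shows "infinite_reg_expansion q (case_nat 0 (\<lambda>i. ps ! (i mod length ps))) (w 0)"
proof -
  let ?n = "length ps"
  \<comment> \<open>The tail at position \<open>l\<close>: the rest of the current period applied to
    the tail at the start of the next.\<close>
  define x where "x l = cf_apply (drop (l mod ?n) ps) (w (Suc (l div ?n)))" for l
  have n: "?n > 0" using assms(1) by simp
  have "x l = - 1 / (of_int (ps ! (l mod ?n)) * lam + x (Suc l))" for l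
  proof -
    have "drop (l mod ?n) ps = ps ! (l mod ?n) # drop (Suc (l mod ?n)) ps"
      using n by (simp add: Cons_nth_drop_Suc)
    moreover have "cf_apply (drop (Suc (l mod ?n)) ps) (w (Suc (l div ?n))) = x (Suc l)"
    proof (cases "Suc (l mod ?n) = ?n")
      case True
      then have "Suc l mod ?n = 0" "Suc l div ?n = Suc (l div ?n)"
        by (simp_all add: mod_Suc div_Suc)
      then show ?thesis using True w[of "Suc (l div ?n)"] by (simp add: x_def)
    next
      case False
      then have "Suc l mod ?n = Suc (l mod ?n)" "Suc l div ?n = l div ?n"
        by (simp_all add: mod_Suc div_Suc)
      then show ?thesis by (simp add: x_def)
    qed
    ultimately show ?thesis by (simp add: x_def)
  qed
  then have c: "chain (\<lambda>i. ps ! (i mod ?n)) m x" for m unfolding chain_def by blast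
  have xi: "- lam / 2 \<le> x i \<and> x i < 0" for i unfolding x_def by (intro B) (use n in simp)
  moreover have "\<bar>x i\<bar> \<le> lam / 2" "x i \<noteq> 0" for i using xi[of i] lam_pos by linarith+
  moreover have "x 0 = w 0" unfolding x_def using w[of 0] by simp
  ultimately show ?thesis
    using infinite_expansion_of_chain[of "case_nat 0 (\<lambda>i. ps ! (i mod ?n))" x] c by simp
qed

lemma cf_apply_replicate: "cf_apply (replicate n 1) t = (f ^^ n) t"
  by (induction n) (auto simp: f_def)

lemma cf_apply_2: "cf_apply [2] t = f (lam + t)"
  by (simp add: f_def)

lemma r_point_eqI:
  assumes "\<And>k. w k = cf_apply (r_period q) (w (Suc k))"
    and "\<And>j k. j < length (r_period q) \<Longrightarrow>
      - lam / 2 \<le> cf_apply (drop j (r_period q)) (w (Suc k)) \<and> cf_apply (drop j (r_period q)) (w (Suc k)) < 0"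
  shows "r_point q = w 0"
proof -
  have d: "r_digits q = case_nat 0 (\<lambda>i. r_period q ! (i mod length (r_period q)))"
    by (auto simp: r_digits_def fun_eq_iff split: nat.split)
  have "infinite_reg_expansion q (r_digits q) (w 0)"
    unfolding d by (rule infinite_expansion_periodic[of "r_period q" w, OF _ assms])
      (simp_all add: r_period_def Let_def)
  then show ?thesis unfolding r_point_def infinite_reg_expansion_def by (blast intro: limI)
qed

text \<open>A digit 2 is a digit 1 after a shift by \<open>lam\<close>, so this block acts as
  \<open>f ^^ h\<close> on the positive point \<open>lam + t\<close>, where the bounds on iterates
  apply.\<close>

lemma ones_two_bounds:
  assumes "0 < lam + t" "h \<ge> 1"
  shows "cf_apply (replicate (h - 1) 1 @ [2]) t = (f ^^ h) (lam + t)"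
    and "j < h \<Longrightarrow> - lam / 2 \<le> cf_apply (drop j (replicate (h - 1) 1 @ [2])) t \<and>
      cf_apply (drop j (replicate (h - 1) 1 @ [2])) t < 0"
proof -
  have "(f ^^ (h - 1)) (f (lam + t)) = (f ^^ Suc (h - 1)) (lam + t)" by (simp add: funpow_swap1)
  then show "cf_apply (replicate (h - 1) 1 @ [2]) t = (f ^^ h) (lam + t)"
    using assms(2) by (simp add: cf_apply_replicate cf_apply_2 del: cf_apply_simps(2))
  assume j: "j < h"
  then have "drop j (replicate (h - 1) 1 @ [2]) = replicate (h - 1 - j) 1 @ [2::int]" by simp
  moreover have "(f ^^ (h - 1 - j)) (f (lam + t)) = (f ^^ Suc (h - 1 - j)) (lam + t)"
    by (simp add: funpow_swap1)
  ultimately have "cf_apply (drop j (replicate (h - 1) 1 @ [2])) t = (f ^^ Suc (h - 1 - j)) (lam + t)"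
    by (simp add: cf_apply_replicate cf_apply_2 del: cf_apply_simps(2))
  then show "- lam / 2 \<le> cf_apply (drop j (replicate (h - 1) 1 @ [2])) t \<and>
      cf_apply (drop j (replicate (h - 1) 1 @ [2])) t < 0"
    using f_iter_lower(1)[of "lam + t" "Suc (h - 1 - j)"] f_iter_upper[of "lam + t" "Suc (h - 1 - j)"]
      assms j by simp
qed

text \<open>With \<open>w k = z k - lam\<close> the relation reads
  \<open>w k = (f ^^ h) (lam + w (Suc k))\<close>, which is one period.\<close>

lemma r_point_even:
  assumes "even q" "\<And>k. z k > 0" "\<And>k. z k = lam + (f ^^ h) (z (Suc k))"
  shows "r_point q = z 0 - lam"
proof -
  have "q \<noteq> 3" using assms(1) by auto
  then have p: "r_period q = replicate (h - 1) 1 @ [2]"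
    using assms(1) by (simp add: r_period_def Let_def)
  have h: "h \<ge> 1" by (rule h_pos[OF assms(1)])
  show ?thesis
  proof (rule r_point_eqI[of "\<lambda>k. z k - lam"])
    show "z k - lam = cf_apply (r_period q) (z (Suc k) - lam)" for k
      unfolding p using ones_two_bounds(1)[of "z (Suc k) - lam"] assms(2)[of "Suc k"] assms(3)[of k] h by simp
    show "- lam / 2 \<le> cf_apply (drop j (r_period q)) (z (Suc k) - lam) \<and>
        cf_apply (drop j (r_period q)) (z (Suc k) - lam) < 0" if "j < length (r_period q)" for j k
      using that h unfolding p by (intro ones_two_bounds(2)) (simp_all add: assms(2))
  qed
qed

text \<open>With \<open>w k = 1 / z k - lam\<close>, \<open>odd_flip\<close> gives
  \<open>w k = (f ^^ Suc h) (z (Suc k))\<close>, while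
  \<open>z (Suc k) = lam + (f ^^ h) (lam + w (Suc (Suc k)))\<close>. One period therefore covers two
  steps of \<open>z\<close>, and the tails at the starts of periods are \<open>w\<close> at even
  indices.\<close>

lemma r_point_odd:
  assumes "odd q" and z1: "\<And>k. z k > 1" and z: "\<And>k. z k = lam + (f ^^ h) (1 / z (Suc k))"
  shows "r_point q = 1 / z 0 - lam"
proof -
  define w where "w k = 1 / z k - lam" for k
  have lw: "lam + w k = 1 / z k" for k by (simp add: w_def)
  have z0: "z k > 0" for k using z1[of k] by simp
  have w: "w k = (f ^^ Suc h) (z (Suc k))" for k
    using odd_flip[OF assms(1) _ z[of k]] z0[of "Suc k"] unfolding w_def by simp
  \<comment> \<open>The case \<open>i = h\<close> goes one step beyond \<open>f_iter_lower\<close>;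
    it is where \<open>z k > 1\<close> is needed.\<close>
  have B: "- lam / 2 \<le> (f ^^ Suc i) (z k) \<and> (f ^^ Suc i) (z k) < 0" if "i \<le> h" for i k
    using f_iter_lower(1)[of "z k" "Suc i"] f_iter_upper[of "z k" "Suc i"] z0[of k] z1[of k] that
      odd_f_Suc_h_bounds(2)[OF assms(1), of "z k"]
    by (cases "i = h") (auto simp: less_imp_le)
  show ?thesis
  proof (cases "q = 3")
    case True
    then have h0: "h = 0" and l: "lam = 1" and p: "r_period q = [3]"
      using h_eq_0 lam_q3 by (auto simp: r_period_def)
    \<comment> \<open>With \<open>h = 0\<close> and \<open>lam = 1\<close>, \<open>z (Suc k)\<close>
      is 2 plus the tail \<open>w (Suc (Suc k))\<close>, and \<open>f\<close> adds the third
      unit.\<close>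
    have e: "cf_apply [3] (w (Suc (Suc k))) = (f ^^ Suc h) (z (Suc k))" for k
      using z[of "Suc k"] lw[of "Suc (Suc k)"] h0 l by (simp add: f_def)
    have "r_point q = w (2 * 0)"
    proof (rule r_point_eqI[of "\<lambda>k. w (2 * k)"])
      show "w (2 * k) = cf_apply (r_period q) (w (2 * Suc k))" for k
        unfolding p using e[of "2 * k"] w[of "2 * k"] by simp
      show "- lam / 2 \<le> cf_apply (drop j (r_period q)) (w (2 * Suc k)) \<and>
        cf_apply (drop j (r_period q)) (w (2 * Suc k)) < 0" if "j < length (r_period q)" for j k
        using that e[of "2 * k"] B[of h "Suc (2 * k)"] unfolding p by simp
    qed
    then show ?thesis by (simp add: w_def)
  next
    case False
    then have p: "r_period q = replicate h 1 @ [2] @ (replicate (h - 1) 1 @ [2])"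
      using assms(1) by (simp add: r_period_def Let_def)
    have h: "h \<ge> 1" using h_eq_0 False by (cases h) auto
    have u: "cf_apply (replicate (h - 1) 1 @ [2]) (w (Suc (Suc k))) = z (Suc k) - lam" for k
      using ones_two_bounds(1)[of "w (Suc (Suc k))"] lw[of "Suc (Suc k)"] z0 z[of "Suc k"] h by simp
    have e: "cf_apply (replicate i 1 @ [2] @ (replicate (h - 1) 1 @ [2])) (w (Suc (Suc k)))
        = (f ^^ Suc i) (z (Suc k))" for i k
    proof -
      have "cf_apply (replicate i 1 @ [2] @ (replicate (h - 1) 1 @ [2])) (w (Suc (Suc k)))
          = (f ^^ i) (cf_apply [2] (cf_apply (replicate (h - 1) 1 @ [2]) (w (Suc (Suc k)))))"
        by (simp only: cf_apply_simps(3) cf_apply_replicate)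
      then show ?thesis unfolding u cf_apply_2 by (simp add: funpow_swap1)
    qed
    have "r_point q = w (2 * 0)"
    proof (rule r_point_eqI[of "\<lambda>k. w (2 * k)"])
      show "w (2 * k) = cf_apply (r_period q) (w (2 * Suc k))" for k
        unfolding p using e[of h "2 * k"] w[of "2 * k"] by simp
      show "- lam / 2 \<le> cf_apply (drop j (r_period q)) (w (2 * Suc k)) \<and>
        cf_apply (drop j (r_period q)) (w (2 * Suc k)) < 0" if j: "j < length (r_period q)" for j k
      proof (cases "j \<le> h")
        case True
        then have "drop j (r_period q) = replicate (h - j) 1 @ [2] @ (replicate (h - 1) 1 @ [2])"
          unfolding p by simp
        then show ?thesis using e[of "h - j" "2 * k"] B[of "h - j" "Suc (2 * k)"] by simp
      next
        case False
        then obtain i where i: "j = h + Suc i" by (metis add_Suc_right less_imp_Suc_add not_le)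
        then have "drop j (r_period q) = drop i (replicate (h - 1) 1 @ [2])" "i < h"
          using j h unfolding p by auto
        then show ?thesis
          using ones_two_bounds(2)[of "w (2 * Suc k)" i] lw[of "2 * Suc k"] z0 h by simp
      qed
    qed
    then show ?thesis by (simp add: w_def)
  qed
qed

section \<open>Comparing \<open>z\<close> and \<open>- 1 / z\<close>\<close>

text \<open>The nearest-multiple map is not odd, because ties are broken to one side; hence \<open>merge\<close> is
  not visibly invariant under negation and both signs are carried along.\<close>

definition merge2 :: "real \<Rightarrow> real \<Rightarrow> bool" where
  "merge2 x y \<longleftrightarrow> merge x y \<and> merge (- x) (- y)"

lemma merge2_refl [simp]: "merge2 x x" by (simp add: merge2_def)

lemma merge2_sym: "merge2 x y \<Longrightarrow> merge2 y x"
  by (auto simp: merge2_def merge_sym)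

lemma merge2_trans [trans]: "merge2 x y \<Longrightarrow> merge2 y z \<Longrightarrow> merge2 x z"
  by (auto simp: merge2_def intro: merge_trans)

lemma merge2_uminus: "merge2 x y \<Longrightarrow> merge2 (- x) (- y)"
  by (auto simp: merge2_def)

lemma merge2_add_lam: "merge2 (lam + x) x"
proof -
  have "merge (lam + x) x" by (rule merge_sym[OF merge_add_lam(1)])
  moreover have "merge (- x - lam) (- x)" by (rule merge_sym[OF merge_add_lam(2)])
  moreover have "- x - lam = - (lam + x)" by simp
  ultimately show ?thesis unfolding merge2_def by metis
qed

lemma merge2_inv: "\<bar>x\<bar> < lam / 2 \<Longrightarrow> merge2 x (- 1 / x)"
  using merge_inv[of x] merge_inv[of "- x"] by (auto simp: merge2_def abs_less_iff)

lemma merge2_f: "\<bar>f t\<bar> < lam / 2 \<Longrightarrow> merge2 (f t) t"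
proof -
  assume "\<bar>f t\<bar> < lam / 2"
  then have "merge2 (f t) (- 1 / f t)" by (rule merge2_inv)
  also have "- 1 / f t = lam + t" by (simp add: f_def)
  also have "merge2 \<dots> t" by (rule merge2_add_lam)
  finally show ?thesis .
qed

lemma merge2_f_iter:
  assumes "\<And>j. 0 < j \<Longrightarrow> j \<le> k \<Longrightarrow> \<bar>(f ^^ j) t\<bar> < lam / 2"
  shows "merge2 ((f ^^ k) t) t"
  using assms
proof (induction k)
  case (Suc k)
  have "merge2 (f ((f ^^ k) t)) ((f ^^ k) t)" using Suc.prems[of "Suc k"] by (intro merge2_f) simp
  also have "merge2 \<dots> t" using Suc by simp
  finally show ?case by simp
qed simp

lemma merge2_f_iter_nonneg:
  assumes "0 \<le> t" "k \<le> h" "0 < t \<or> k < h \<or> odd q"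
  shows "merge2 ((f ^^ k) t) t"
proof (rule merge2_f_iter)
  fix j assume "0 < j" "j \<le> k"
  then show "\<bar>(f ^^ j) t\<bar> < lam / 2"
    using f_iter_lower(2)[of t j] f_iter_upper[of t j] assms lam_pos by (auto simp: abs_less_iff)
qed

lemma merge2_odd_f_Suc_h:
  assumes "odd q" "1 < t"
  shows "merge2 ((f ^^ Suc h) t) t"
proof -
  have "merge2 (f ((f ^^ h) t)) ((f ^^ h) t)"
    using odd_f_Suc_h_bounds(2)[OF assms] f_iter_upper[of t "Suc h"] assms lam_pos
    by (intro merge2_f) (auto simp: abs_less_iff)
  also have "merge2 \<dots> t" using assms by (intro merge2_f_iter_nonneg) auto
  finally show ?thesis by simp
qed

text \<open>These are the end points left out by the strict inequalities in the case distinctions on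
  \<open>z\<close>. For \<open>q\<close> odd, \<open>1 = lam + (f ^^ h) 0\<close> and
  \<open>2 / lam = lam + (f ^^ h) 1\<close>; for \<open>q\<close> even,
  \<open>2 / lam = lam + (f ^^ (h - 1)) 0\<close>.\<close>

lemma merge2_cusps:
  shows "merge2 (2 / lam) 0" "merge2 (lam / 2) 0" "odd q \<Longrightarrow> merge2 1 0"
proof -
  show 1: "merge2 1 0" if "odd q"
    using merge2_trans[OF merge2_add_lam[of "(f ^^ h) 0"] merge2_f_iter_nonneg[of 0 h]]
      odd_f_h_0 that by simp
  show 2: "merge2 (2 / lam) 0"
  proof (cases "even q")
    case True
    then obtain g where g: "h = Suc g" using h_pos by (cases h) auto
    have "inverse (lam + (f ^^ g) 0) = lam / 2"
      using even_f_h_0[OF True] by (simp add: g f_def inverse_eq_divide)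
    then have "lam + (f ^^ g) 0 = inverse (lam / 2)" by (metis inverse_inverse_eq)
    then show ?thesis
      using merge2_trans[OF merge2_add_lam[of "(f ^^ g) 0"] merge2_f_iter_nonneg[of 0 g]] g by simp
  next
    case False
    have "merge2 (2 / lam) 1"
      using merge2_trans[OF merge2_add_lam[of "(f ^^ h) 1"] merge2_f_iter_nonneg[of 1 h]]
        odd_f_h_1 False by simp
    then show ?thesis using 1[OF False] merge2_trans by blast
  qed
  \<comment> \<open>\<open>merge_inv\<close> admits the left end point only, so
    \<open>- lam / 2\<close> is treated by inversion and \<open>lam / 2\<close> by a further
    translation.\<close>
  have m: "merge (- lam / 2) (2 / lam)" using merge_inv[of "- lam / 2"] lam_pos by simp
  then have m0: "merge (- (lam / 2)) 0" using 2 merge_trans by (auto simp: merge2_def)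
  have "merge (lam / 2) (lam / 2 - lam)" by (rule merge_add_lam)
  then have "merge (lam / 2) (- (lam / 2))" by simp
  then show "merge2 (lam / 2) 0" using m0 merge_trans by (auto simp: merge2_def)
qed

lemma merge2_inv_of_zero: "merge2 z 0 \<Longrightarrow> merge2 (1 / z) 0 \<Longrightarrow> merge2 z (- 1 / z)"
  using merge2_trans[of z 0 "- (1 / z)"] merge2_uminus[of "1 / z" 0] by (simp add: merge2_sym)

text \<open>Used in contrapositive form: if the tails of \<open>z\<close> and \<open>- 1 / z\<close>
  differ, then so do those of \<open>t\<close> and \<open>- 1 / t\<close>, and the comparison can be
  repeated with \<open>t\<close>.\<close>

lemma merge2_inv_transfer:
  assumes "merge2 z t" "merge2 (1 / z) (1 / t)" "merge2 t (- 1 / t)"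
  shows "merge2 z (- 1 / z)"
proof -
  have "merge2 (- 1 / t) (- 1 / z)" using merge2_sym[OF merge2_uminus[OF assms(2)]] by simp
  then show ?thesis using assms(1,3) merge2_trans by blast
qed

lemma merge2_inv_inverse: "merge2 z (- 1 / z) \<Longrightarrow> merge2 (1 / z) (- 1 / (1 / z))"
  using merge2_sym[OF merge2_uminus[of z "- 1 / z"]] by simp

text \<open>Below \<open>lam / 2\<close> inversion is a step of the map, and \<open>lam / 2\<close>
  itself merges with 0. The upper bound is the lower one for \<open>1 / z\<close>.\<close>

lemma not_merge2_inv_bounds:
  assumes "z > 0" "\<not> merge2 z (- 1 / z)"
  shows "lam / 2 < z" "z < 2 / lam"
proof -
  have ge: "lam / 2 < z" if z: "z > 0" "\<not> merge2 z (- 1 / z)" for z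
  proof (rule ccontr)
    assume "\<not> lam / 2 < z"
    then consider "\<bar>z\<bar> < lam / 2" | "z = lam / 2" using z by linarith
    then show False
    proof cases
      case 1
      then show False using z merge2_inv by blast
    next
      case 2
      have "1 / z = 2 / lam" unfolding 2 by simp
      then show False using 2 z(2) merge2_inv_of_zero[of z] merge2_cusps(1,2) by metis
    qed
  qed
  then show "lam / 2 < z" using assms by blast
  have "lam / 2 < 1 / z"
    using ge[of "1 / z"] assms merge2_inv_inverse[of "1 / z"] by auto
  then show "z < 2 / lam" using assms(1) lam_pos by (simp add: field_simps)
qed

lemma even_step:
  assumes "even q" "z > 0" "\<not> merge2 z (- 1 / z)"
  shows "\<exists>t>0. \<not> merge2 t (- 1 / t) \<and> z = lam + (f ^^ h) t"
proof -
  obtain t where t: "t > 0" "z = lam + (f ^^ h) t"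
    using even_split[OF assms(1) not_merge2_inv_bounds[OF assms(2,3)]] by blast
  have m: "merge2 (lam + (f ^^ h) s) s" if "s > 0" for s
    using merge2_trans[OF merge2_add_lam merge2_f_iter_nonneg[of s h]] that by simp
  have "merge2 z t" "merge2 (1 / z) (1 / t)"
    using m[of t] m[of "1 / t"] t even_flip[OF assms(1) t] by simp_all
  then show ?thesis using t assms(3) merge2_inv_transfer by blast
qed

text \<open>\<open>odd_split\<close> yields a parameter in (0, 1); its reciprocal is passed on, so
  that the hypothesis of being larger than 1 is reproduced.\<close>

lemma odd_step:
  assumes "odd q" "z > 1" "\<not> merge2 z (- 1 / z)"
  shows "\<exists>t>1. \<not> merge2 t (- 1 / t) \<and> z = lam + (f ^^ h) (1 / t) \<and> merge2 z (1 / t)"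
proof -
  have "z < 2 / lam" using not_merge2_inv_bounds(2)[of z] assms by simp
  then obtain t where t: "t > 0" "t < 1" "z = lam + (f ^^ h) t"
    using odd_split[OF assms(1,2)] by blast
  have "merge2 z t"
    using merge2_trans[OF merge2_add_lam merge2_f_iter_nonneg[of t h]] t by simp
  moreover have "merge2 (1 / z) (1 / t)"
    using merge2_trans[OF merge2_add_lam merge2_odd_f_Suc_h[of "1 / t"]] t assms(1)
      odd_flip[OF assms(1) t(1,3)] by simp
  ultimately have "\<not> merge2 t (- 1 / t)" "merge2 z t" using assms(3) merge2_inv_transfer by blast+
  then show ?thesis using t merge2_inv_inverse[of "1 / t"] by (intro exI[of _ "1 / t"]) auto
qed

text \<open>\<open>even_step\<close> reproduces its hypothesis, so dependent choice yields an
  infinite sequence. By \<open>even_flip\<close> the reciprocals obey the same recursion, and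
  \<open>r_point_even\<close> applies to both sequences.\<close>

lemma merge2_r_even:
  assumes "even q" "z > 0" "\<not> merge2 z (- 1 / z)"
  shows "merge2 z (r_point q) \<and> merge2 (1 / z) (r_point q)"
proof -
  have "\<exists>\<zeta>. \<forall>n. (\<zeta> n > 0 \<and> \<not> merge2 (\<zeta> n) (- 1 / \<zeta> n) \<and> (n = 0 \<longrightarrow> \<zeta> n = z)) \<and>
      \<zeta> n = lam + (f ^^ h) (\<zeta> (Suc n))"
  proof (rule dependent_nat_choice)
    fix x and n :: nat
    assume "0 < x \<and> \<not> merge2 x (- 1 / x) \<and> (n = 0 \<longrightarrow> x = z)"
    then obtain t where "t > 0" "\<not> merge2 t (- 1 / t)" "x = lam + (f ^^ h) t"
      using even_step[OF assms(1)] by blast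
    then show "\<exists>y. (0 < y \<and> \<not> merge2 y (- 1 / y) \<and> (Suc n = 0 \<longrightarrow> y = z)) \<and> x = lam + (f ^^ h) y"
      by blast
  qed (use assms in blast)
  then obtain \<zeta> where \<zeta>: "\<And>n. \<zeta> n > 0" "\<zeta> 0 = z" "\<And>n. \<zeta> n = lam + (f ^^ h) (\<zeta> (Suc n))" by metis
  have "r_point q = \<zeta> 0 - lam" using assms(1) \<zeta>(1,3) by (rule r_point_even)
  moreover have "r_point q = 1 / \<zeta> 0 - lam"
  proof (rule r_point_even[OF assms(1)])
    show "1 / \<zeta> k > 0" for k using \<zeta>(1)[of k] by simp
    show "1 / \<zeta> k = lam + (f ^^ h) (1 / \<zeta> (Suc k))" for k
      using even_flip[OF assms(1) \<zeta>(1) \<zeta>(3)] .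
  qed
  ultimately have "z = lam + r_point q" "1 / z = lam + r_point q" unfolding \<zeta>(2) by linarith+
  then show ?thesis using merge2_add_lam by metis
qed

text \<open>\<open>r_point_odd\<close> for the whole sequence handles \<open>1 / z\<close>; for the
  sequence without its first term it handles the reciprocal of the next point, with which
  \<open>z\<close> merges.\<close>

lemma merge2_r_odd:
  assumes "odd q" "z > 1" "\<not> merge2 z (- 1 / z)"
  shows "merge2 z (r_point q) \<and> merge2 (1 / z) (r_point q)"
proof -
  have "\<exists>\<zeta>. \<forall>n. (\<zeta> n > 1 \<and> \<not> merge2 (\<zeta> n) (- 1 / \<zeta> n) \<and> (n = 0 \<longrightarrow> \<zeta> n = z)) \<and>
      \<zeta> n = lam + (f ^^ h) (1 / \<zeta> (Suc n)) \<and> merge2 (\<zeta> n) (1 / \<zeta> (Suc n))"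
  proof (rule dependent_nat_choice)
    fix x and n :: nat
    assume "1 < x \<and> \<not> merge2 x (- 1 / x) \<and> (n = 0 \<longrightarrow> x = z)"
    then obtain t where "t > 1" "\<not> merge2 t (- 1 / t)" "x = lam + (f ^^ h) (1 / t)" "merge2 x (1 / t)"
      using odd_step[OF assms(1)] by blast
    then show "\<exists>y. (1 < y \<and> \<not> merge2 y (- 1 / y) \<and> (Suc n = 0 \<longrightarrow> y = z)) \<and>
        x = lam + (f ^^ h) (1 / y) \<and> merge2 x (1 / y)"
      by blast
  qed (use assms in blast)
  then obtain \<zeta> where \<zeta>: "\<And>n. \<zeta> n > 1" "\<zeta> 0 = z"
    "\<And>n. \<zeta> n = lam + (f ^^ h) (1 / \<zeta> (Suc n))" "\<And>n. merge2 (\<zeta> n) (1 / \<zeta> (Suc n))" by metis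
  have "1 / z = lam + r_point q"
    using r_point_odd[of \<zeta>, OF assms(1) \<zeta>(1,3)] unfolding \<zeta>(2) by linarith
  moreover have "1 / \<zeta> (Suc 0) = lam + r_point q"
    using r_point_odd[of "\<lambda>k. \<zeta> (Suc k)", OF assms(1) \<zeta>(1,3)] by linarith
  ultimately show ?thesis using merge2_add_lam merge2_trans[OF \<zeta>(4)[of 0]] \<zeta>(2) by metis
qed

lemma merge2_inv_or_r:
  assumes "z > 0"
  shows "merge2 z (- 1 / z) \<or> merge2 z (r_point q) \<and> merge2 (1 / z) (r_point q)"
proof (cases "even q")
  case True
  then show ?thesis using merge2_r_even assms by blast
next
  case False
  consider "z > 1" | "z = 1" | "1 / z > 1" using assms by (cases "z < 1"; force)
  then show ?thesis
  proof cases
    case 1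
    then show ?thesis using merge2_r_odd False by blast
  next
    case 2
    then show ?thesis using merge2_cusps(3)[OF False] merge2_inv_of_zero[of 1] by simp
  next
    case 3
    then have "merge2 (1 / z) (- 1 / (1 / z)) \<or>
        merge2 (1 / z) (r_point q) \<and> merge2 (1 / (1 / z)) (r_point q)"
      using merge2_r_odd[OF False, of "1 / z"] by blast
    then show ?thesis using merge2_inv_inverse[of "1 / z"] by auto
  qed
qed

text \<open>Condition (2) with \<open>merge\<close> in place of \<open>reg_equiv\<close>;
  transitivity, needed for the induction over the generators, is easy in this form.\<close>

definition hecke_rel :: "real \<Rightarrow> real \<Rightarrow> bool" where
  "hecke_rel x y \<longleftrightarrow> merge x y \<or> (merge x (r_point q) \<and> merge y (- r_point q)) \<or>
    (merge x (- r_point q) \<and> merge y (r_point q))"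

lemma hecke_rel_sym: "hecke_rel x y \<Longrightarrow> hecke_rel y x"
  by (auto simp: hecke_rel_def merge_sym)

lemma hecke_rel_trans: "hecke_rel x y \<Longrightarrow> hecke_rel y z \<Longrightarrow> hecke_rel x z"
  unfolding hecke_rel_def by (meson merge_sym merge_trans)

lemma hecke_rel_inv: "hecke_rel z (- 1 / z)"
proof -
  consider "z > 0" | "z = 0" | "- z > 0" by linarith
  then show ?thesis
  proof cases
    case 1
    then show ?thesis using merge2_inv_or_r[of z] by (auto simp: hecke_rel_def merge2_def)
  next
    case 3
    then show ?thesis using merge2_inv_or_r[of "- z"] by (auto simp: hecke_rel_def merge2_def)
  qed (simp add: hecke_rel_def)
qed

lemma hecke_rel_add_lam: "hecke_rel x (x + lam)"
  using merge_add_lam(1)[of x] by (simp add: hecke_rel_def add.commute)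

lemma hecke_rel_imp_reg_equiv:
  "hecke_rel x y \<Longrightarrow> reg_equiv q x y \<or>
    (reg_equiv q x (r_point q) \<and> reg_equiv q y (- r_point q)) \<or>
    (reg_equiv q x (- r_point q) \<and> reg_equiv q y (r_point q))"
  using merge_imp_reg_equiv by (auto simp: hecke_rel_def)

section \<open>The two equivalence relations\<close>

abbreviation orbit_eq :: "real \<Rightarrow> real \<Rightarrow> bool" where
  "orbit_eq x y \<equiv> same_orbit q (Some x) (Some y)"

lemma same_orbit_imp_hecke_rel:
  assumes "orbit_eq x y"
  shows "hecke_rel x y"
proof -
  \<comment> \<open>Infinity is represented by 0: \<open>S\<close> exchanges the two points and
    \<open>T\<close> fixes infinity, so the generators still respect the relation.\<close>
  let ?v = "case_option 0 (\<lambda>x. x)"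
  have "hecke_rel (?v (Some x)) (?v (Some y))"
    using assms
  proof (rule same_orbit_induct)
    show "hecke_rel (?v p) (?v (psl_act (psl_class hecke_S) p))" for p
      using hecke_rel_inv by (cases p) (auto simp: hecke_S_act hecke_rel_def)
    show "hecke_rel (?v p) (?v (psl_act (psl_class (hecke_T q)) p))" for p
      using hecke_rel_add_lam by (cases p) (auto simp: hecke_T_act hecke_rel_def)
  qed (auto simp: hecke_rel_def[of x x for x] intro: hecke_rel_sym hecke_rel_trans)
  then show ?thesis by simp
qed

lemma orbit_eq_chain:
  assumes "x = - 1 / (of_int d * lam + t)" "x \<noteq> 0"
  shows "orbit_eq x t"
proof -
  have "orbit_eq t (of_int d * lam + t)" by (rule same_orbit_add)
  also have "same_orbit q \<dots> (Some x)" using same_orbit_S(1)[of "of_int d * lam + t" q] assms by auto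
  finally show ?thesis by (rule same_orbit_sym)
qed

lemma finite_expansion_orbit:
  assumes "finite_reg_expansion q as x"
  shows "same_orbit q (Some x) None"
proof -
  let ?b = "\<lambda>i. as ! Suc i" and ?n = "length as - 1"
  have a: "admissible ?b ?n" and ne: "as \<noteq> []" and x: "x = lcf_value q as"
    using assms by (auto simp: finite_reg_expansion_def regular_finite_iff)
  have "orbit_eq (tail_val ?b ?n l) 0" if "l \<le> ?n" for l
    using that
  proof (induction l rule: inc_induct)
    case (step l)
    then have "orbit_eq (tail_val ?b ?n l) (tail_val ?b ?n (Suc l))"
      by (intro orbit_eq_chain[OF tail_val_less] tail_val_nonzero[OF a])
    then show ?case using step.IH same_orbit_trans by blast
  qed simp
  then have "orbit_eq (tail_val ?b ?n 0) 0" by simp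
  moreover have "orbit_eq (tail_val ?b ?n 0) x"
    unfolding x lcf_value_eq[OF ne] by (rule same_orbit_add)
  ultimately show ?thesis using same_orbit_S(2) same_orbit_sym same_orbit_trans by blast
qed

text \<open>\<open>reg_equiv\<close> allows arbitrary regular expansions, so convergence of their
  tails has to be proved. The recursion is solved for the next tail, which requires that the limit
  of the present one is nonzero.\<close>

lemma infinite_expansion_tail:
  assumes "infinite_reg_expansion q a x"
  shows "\<exists>y. (\<lambda>n. tail_val (\<lambda>i. a (Suc i)) n m) \<longlonglongrightarrow> y \<and> orbit_eq x y"
proof (induction m)
  case 0
  let ?t = "\<lambda>n. tail_val (\<lambda>i. a (Suc i)) n 0"
  have "(\<lambda>n. of_int (a 0) * lam + ?t n - of_int (a 0) * lam) \<longlonglongrightarrow> x - of_int (a 0) * lam"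
    using assms by (intro tendsto_intros)
      (simp add: infinite_reg_expansion_def lcf_convergent_eq[abs_def])
  then have "?t \<longlonglongrightarrow> x - of_int (a 0) * lam" by simp
  moreover have "orbit_eq (x - of_int (a 0) * lam) x"
    using same_orbit_add[of q "x - of_int (a 0) * lam" "a 0"] by simp
  ultimately show ?case using same_orbit_sym by blast
next
  case (Suc m)
  let ?b = "\<lambda>i. a (Suc i)"
  have adm: "admissible ?b n" for n
    using assms by (simp add: infinite_reg_expansion_def regular_infinite_iff)
  obtain y where y: "(\<lambda>n. tail_val ?b n m) \<longlonglongrightarrow> y" "orbit_eq x y" using Suc by blast
  \<comment> \<open>Upper bound for the denominators of all truncated tails at \<open>m\<close>; it
    keeps these tails, and so their limit, away from 0.\<close>
  define D where "D = (\<bar>of_int (?b m)\<bar> + 1) * lam"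
  have D: "D > 0" using lam_pos by (simp add: D_def add_nonneg_pos)
  have "1 / D \<le> \<bar>tail_val ?b n m\<bar>" if "m < n" for n
  proof -
    let ?X = "of_int (?b m) * lam + tail_val ?b n (Suc m)"
    have "\<bar>?X\<bar> \<le> \<bar>of_int (?b m) * lam\<bar> + \<bar>tail_val ?b n (Suc m)\<bar>" by (rule abs_triangle_ineq)
    also have "\<dots> \<le> D"
      using admissible_bound[OF adm, of "Suc m" n] that lam_pos
      by (simp add: D_def distrib_right abs_mult)
    finally have X: "\<bar>?X\<bar> \<le> D" .
    have "?X \<noteq> 0" using tail_val_nonzero[OF adm that] tail_val_less[OF that, of ?b] by auto
    then have "1 / D \<le> 1 / \<bar>?X\<bar>" using X by (intro divide_left_mono) auto
    then show ?thesis using tail_val_less[OF that, of ?b] by simp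
  qed
  then have "\<forall>\<^sub>F n in sequentially. 1 / D \<le> \<bar>tail_val ?b n m\<bar>"
    unfolding eventually_sequentially using Suc_le_eq by blast
  then have "1 / D \<le> \<bar>y\<bar>"
    using tendsto_lowerbound[OF tendsto_rabs[OF y(1)]] by simp
  then have y0: "y \<noteq> 0" using D by auto
  let ?y = "- 1 / y - of_int (?b m) * lam"
  have "(\<lambda>n. - 1 / tail_val ?b n m - of_int (?b m) * lam) \<longlonglongrightarrow> ?y"
    by (intro tendsto_intros y(1) y0)
  moreover have "- 1 / tail_val ?b n m - of_int (?b m) * lam = tail_val ?b n (Suc m)" if "m < n" for n
    using tail_val_less[OF that, of ?b] by simp
  then have "\<forall>\<^sub>F n in sequentially.
      - 1 / tail_val ?b n m - of_int (?b m) * lam = tail_val ?b n (Suc m)"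
    unfolding eventually_sequentially using Suc_le_eq by blast
  ultimately have "(\<lambda>n. tail_val ?b n (Suc m)) \<longlonglongrightarrow> ?y"
    by (rule Lim_transform_eventually)
  moreover have "orbit_eq y ?y" using y0 by (intro orbit_eq_chain[of _ "?b m"]) simp_all
  ultimately show ?case using y(2) same_orbit_trans by blast
qed

lemma tail_val_shift:
  assumes "\<And>k. b (m + k) = c (n + k)"
  shows "tail_val b (m + N) m = tail_val c (n + N) n"
proof -
  have "map b [m..<m + N] = map c [n..<n + N]"
    using assms by (intro nth_equalityI) auto
  then show ?thesis by (simp add: tail_val_def)
qed

lemma reg_equiv_imp_orbit_eq:
  assumes "reg_equiv q x y"
  shows "orbit_eq x y"
  using assms unfolding reg_equiv_def
proof (elim disjE exE conjE)
  fix a b m n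
  assume a: "infinite_reg_expansion q a x" and b: "infinite_reg_expansion q b y"
    and mn: "\<forall>k. a (m + k) = b (n + k)"
  obtain u where u: "(\<lambda>N. tail_val (\<lambda>i. a (Suc i)) N m) \<longlonglongrightarrow> u" "orbit_eq x u"
    using infinite_expansion_tail[OF a] by blast
  obtain v where v: "(\<lambda>N. tail_val (\<lambda>i. b (Suc i)) N n) \<longlonglongrightarrow> v" "orbit_eq y v"
    using infinite_expansion_tail[OF b] by blast
  \<comment> \<open>The tail at \<open>m\<close> reads the digits of \<open>a\<close> from
    \<open>m + 1\<close> on, so the hypothesis is used at positive offsets. The truncation points
    are shifted by \<open>m\<close> and \<open>n\<close> to give equal lengths.\<close>
  have e: "tail_val (\<lambda>i. a (Suc i)) (N + m) m = tail_val (\<lambda>i. b (Suc i)) (N + n) n" for N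
    using tail_val_shift[of "\<lambda>i. a (Suc i)" m "\<lambda>i. b (Suc i)" n N] mn[rule_format, of "Suc _"]
    by (simp add: add.commute)
  have "(\<lambda>N. tail_val (\<lambda>i. b (Suc i)) (N + n) n) \<longlonglongrightarrow> u"
    using LIMSEQ_ignore_initial_segment[OF u(1), of m] unfolding e .
  then have "u = v" using LIMSEQ_ignore_initial_segment[OF v(1), of n] LIMSEQ_unique by blast
  then show ?thesis using u(2) v(2) same_orbit_sym same_orbit_trans by blast
next
  fix as bs
  assume "finite_reg_expansion q as x" "finite_reg_expansion q bs y"
  then show ?thesis using finite_expansion_orbit same_orbit_sym same_orbit_trans by blast
qed

section \<open>Equivalence of r_q and - r_q under the Hecke group\<close>

lemma orbit_eq_f_iter:
  assumes "0 < t" "k \<le> h"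
  shows "orbit_eq ((f ^^ k) t) t"
  using assms(2)
proof (induction k)
  case (Suc k)
  have "(f ^^ Suc k) t \<noteq> 0" using f_iter_upper[of t "Suc k"] Suc.prems assms(1) by simp
  then have "orbit_eq ((f ^^ Suc k) t) ((f ^^ k) t)"
    by (intro orbit_eq_chain[of _ 1]) (simp_all add: f_def)
  also have "same_orbit q \<dots> (Some t)" using Suc by simp
  finally show ?case .
qed simp

text \<open>Provides a constant sequence for \<open>r_point_odd\<close>. The intermediate value
  theorem is applied on [1, 2 / lam]: at 1 the iterate part equals \<open>2 / lam > 1\<close>, and
  at \<open>2 / lam\<close> it is smaller than \<open>2 / lam\<close> by monotonicity of
  \<open>f ^^ h\<close>.\<close>

lemma odd_fixed_point:
  assumes "odd q"
  obtains z where "z > 1" "z = lam + (f ^^ h) (1 / z)"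
proof -
  define g where "g z = lam + (f ^^ h) (1 / z) - z" for z
  let ?F = "\<lambda>z. (sn (Suc h) * (1 / z) + sn (Suc h)) / (sn h * (1 / z) + sn (Suc h)) - z"
  have g: "g z = ?F z" if "z > 0" for z
    using f_iter_closed[of "1 / z" h] that q_odd[OF assms] sn_odd(1)[OF assms] by (simp add: g_def)
  have l: "1 < 2 / lam" using lam_less_2 lam_pos by simp
  have "continuous_on {1..2 / lam} ?F"
  proof (intro continuous_intros ballI)
    fix z assume "z \<in> {1..2 / lam}"
    then have z: "0 \<le> 1 / z" "z \<noteq> 0" by auto
    show "sn h * (1 / z) + sn (Suc h) \<noteq> 0"
      using sn_den_pos[OF z(1), of h] q_odd[OF assms] by simp
    show "z \<noteq> 0" by (rule z)
    show "z \<noteq> 0" by (rule z)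
  qed
  then have "continuous_on {1..2 / lam} g"
    by (rule continuous_on_eq) (simp add: g)
  moreover have g1: "g 1 > 0" using odd_f_h_1[OF assms] l by (simp add: g_def)
  moreover have "g (2 / lam) < 0"
  proof -
    have "- lam < (f ^^ j) (lam / 2)" if "j < h" for j
      using f_iter_lower(1)[of "lam / 2" j] that lam_pos by simp
    then have "(f ^^ h) (lam / 2) \<le> (f ^^ h) 1"
      using lam_less_2 by (intro f_iter_mono) simp_all
    moreover have "(f ^^ h) (lam / 2) \<noteq> (f ^^ h) 1"
    proof
      assume "(f ^^ h) (lam / 2) = (f ^^ h) 1"
      moreover have "(f ^^ h) (lam / 2) < (f ^^ h) 1"
        using lam_less_2 f_iter_lower(1)[of "lam / 2"] lam_pos
        by (intro f_iter_strict_mono) (auto intro: less_le_trans[of "- lam" "- lam / 2"])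
      ultimately show False by simp
    qed
    ultimately show ?thesis using odd_f_h_1[OF assms] by (simp add: g_def)
  qed
  ultimately obtain z where z: "1 \<le> z" "g z = 0"
    using IVT2'[of g "2 / lam" 0 1] l by auto
  then have "z \<noteq> 1" using g1 by auto
  then show thesis using that[of z] z by (simp add: g_def)
qed

text \<open>For a fixed point \<open>z\<close> the points \<open>1 / z\<close> and \<open>z\<close>
  are equivalent, \<open>S\<close> sends \<open>z\<close> to \<open>- 1 / z\<close>, and shifts by
  \<open>lam\<close> lead from \<open>r_point q\<close> to \<open>1 / z\<close> and from
  \<open>- 1 / z\<close> to \<open>- r_point q\<close>. For \<open>q\<close> even the fixed point is
  1.\<close>

lemma r_point_orbit: "orbit_eq (r_point q) (- r_point q)"
proof -
  obtain z where z: "z > 0" "orbit_eq (1 / z) z" "r_point q = 1 / z - lam"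
  proof (cases "even q")
    case True
    have "lam + (f ^^ h) 1 = 1"
      using f_iter_closed[of 1 h] q_even[OF True] sn_even[OF True] sn_den_pos[of 1 h]
      by (simp add: add.commute)
    then have "r_point q = 1 - lam" by (intro r_point_even[OF True, of "\<lambda>_. 1"]) simp_all
    then show thesis using that[of 1] by simp
  next
    case False
    obtain z where z: "z > 1" "z = lam + (f ^^ h) (1 / z)" using odd_fixed_point[OF False] by blast
    have "orbit_eq ((f ^^ h) (1 / z)) (1 / z)" using z(1) by (intro orbit_eq_f_iter) simp_all
    moreover have "orbit_eq ((f ^^ h) (1 / z)) (lam + (f ^^ h) (1 / z))"
      using same_orbit_add[of q _ 1] by simp
    ultimately have "orbit_eq (1 / z) z"
      unfolding z(2)[symmetric] using same_orbit_sym same_orbit_trans by blast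
    moreover have "r_point q = 1 / z - lam"
      by (rule r_point_odd[OF False, of "\<lambda>_. z"]) (rule z)+
    ultimately show thesis using that[of z] z(1) by simp
  qed
  have "orbit_eq (r_point q) (1 / z)"
    using same_orbit_add[of q "r_point q" 1] z(3) by simp
  also note z(2)
  also have "orbit_eq z (- 1 / z)" using z(1) by (intro same_orbit_S) simp
  also have "orbit_eq (- 1 / z) (- r_point q)"
    using same_orbit_add[of q "- 1 / z" 1] z(3) by simp
  finally show ?thesis .
qed

end

theorem theorem2p5p1:
  fixes q :: nat and x y :: real
  assumes "q \<ge> 3"
  shows "(\<exists>g\<in>hecke_group q. psl_act g (Some x) = Some y) \<longleftrightarrow>
    reg_equiv q x y \<or>
    (reg_equiv q x (r_point q) \<and> reg_equiv q y (- r_point q)) \<or>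
    (reg_equiv q x (- r_point q) \<and> reg_equiv q y (r_point q))"
proof -
  interpret hecke q using assms by unfold_locales
  show ?thesis
    unfolding same_orbit_def[symmetric]
    using same_orbit_imp_hecke_rel hecke_rel_imp_reg_equiv reg_equiv_imp_orbit_eq r_point_orbit
      same_orbit_sym same_orbit_trans by meson
qed

end
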